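(* Let $d\ge 1$, let $Q$ be a probability measure on $\Omega=\{0,1\}^{\mathbb{Z}^d}$ satisfying the standing assumptions (i) and (ii) of the context, and let $\{X_n\}_{n\ge 0}$ be the random walk on the discrete point process with annealed law $\mathbb{P}$. Then $$\mathbb{P}\left(\lim_{n\to\infty}\frac{X_n}{n}=0\right)=1 .$$
   Context: Setting. $\Omega=\{0,1\}^{\mathbb{Z}^d}$ with its Borel (product) $\sigma$-algebra $\mathfrak{B}$; for $x\in\mathbb{Z}^d$ the shift $\theta_x:\Omega\to\Omega$ is $(\theta_x\omega)(y)=\omega(x+y)$; $e_1,\dots,e_d$ are the standard basis vectors and $\mathcal{E}=\{\pm e_i\}_{i=1}^d$; $\mathcal{P}(\omega)=\{x\in\mathbb{Z}^d:\omega(x)=1\}$. Standing assumptions on $Q$: (i) $Q$ is stationary (invariant) and ergodic with respect to each single shift $\theta_{e_i}$, $i=1,\dots,d$; (ii) $Q(\mathcal{P}(\omega)=\emptyset)<1$. $\Omega_0=\{\omega\in\Omega:\omega(0)=1\}$ (it has positive $Q$-measure), and $P=Q(\cdot\mid\Omega_0)$. For $e\in\mathcal{E}$, $f_e(\omega)=\min\{k>0:\omega(ke)=1\}$ (almost surely finite). For $v\in\mathbb{Z}^d$, $N_v(\omega)=\{v+f_e(\theta_v\omega)e: e\in\mathcal{E}\}$ is the set of the $2d$ coordinate nearest neighbors of $v$, one in each of the $2d$ directions. Random walk. For $P$-a.e. $\omega\in\Omega_0$, the quenched law $P_\omega$ on $(\mathbb{Z}^d)^{\mathbb{N}}$ is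 the law of the Markov chain $\{X_n\}_{n\ge0}$ on $\mathcal{P}(\omega)$ with $X_0=0$ and $P_\omega(X_{n+1}=u\mid X_n=v)=\frac1{2d}$ if $u\in N_v(\omega)$ and $0$ otherwise. The annealed law is $\mathbb{P}(\cdot)=\int_{\Omega_0}P_\omega(\cdot)\,P(d\omega)$. *)

theory Defs
  imports "HOL-Probability.Probability"
begin

section \<open>Point configurations on the integer lattice\<close>

text \<open>
  A 0-1 configuration on \<open>\<int>\<^sup>d\<close>, where \<open>d = CARD('d)\<close>, is encoded as a predicate on lattice
  points, with \<open>True\<close> for 1.
\<close>

type_synonym 'd config = "int ^ 'd \<Rightarrow> bool"

definition config_space :: "'d::finite config measure" where
  "config_space = PiM UNIV (\<lambda>_. count_space UNIV)"

definition lattice_shift :: "int ^ 'd \<Rightarrow> 'd::finite config \<Rightarrow> 'd config" where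
  "lattice_shift x \<omega> = (\<lambda>y. \<omega> (x + y))"

definition points :: "'d::finite config \<Rightarrow> (int ^ 'd) set" where
  "points \<omega> = {x. \<omega> x}"

definition invariant_measure :: "'a measure \<Rightarrow> ('a \<Rightarrow> 'a) \<Rightarrow> bool" where
  "invariant_measure M T \<longleftrightarrow> T \<in> M \<rightarrow>\<^sub>M M \<and> distr M M T = M"

definition ergodic_measure :: "'a measure \<Rightarrow> ('a \<Rightarrow> 'a) \<Rightarrow> bool" where
  "ergodic_measure M T \<longleftrightarrow>
     (\<forall>A \<in> sets M. T -` A \<inter> space M = A \<longrightarrow> measure M A = 0 \<or> measure M A = 1)"

definition origin_occupied :: "'d::finite config set" where
  "origin_occupied = {\<omega>. \<omega> 0}"

text \<open>The conditional measure \<open>P = Q(\<cdot> | \<Omega>\<^sub>0)\<close>.\<close>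

definition conditioned :: "'d::finite config measure \<Rightarrow> 'd config measure" where
  "conditioned Q = uniform_measure Q origin_occupied"


section \<open>Coordinate nearest neighbours\<close>

definition directions :: "(int ^ 'd::finite) set" where
  "directions = range (\<lambda>i. axis i 1) \<union> range (\<lambda>i. - axis i 1)"

text \<open>Unspecified (but independent of \<open>\<omega>\<close>) if there is no point in the given direction.\<close>

definition first_point :: "int ^ 'd \<Rightarrow> 'd::finite config \<Rightarrow> nat" where
  "first_point e \<omega> = (LEAST k. 0 < k \<and> \<omega> (int k *s e))"

definition neighbours :: "'d::finite config \<Rightarrow> int ^ 'd \<Rightarrow> (int ^ 'd) set" where
  "neighbours \<omega> v = {v + int (first_point e (lattice_shift v \<omega>)) *s e | e. e \<in> directions}"


section \<open>The random walk\<close>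

text \<open>
  The uniform distribution on the neighbours; lemma \<open>pmf_walk_step\<close> below gives the transition
  probabilities \<open>1/(2d)\<close> whenever all neighbours of \<open>v\<close> exist.
\<close>

definition walk_step :: "'d::finite config \<Rightarrow> int ^ 'd \<Rightarrow> (int ^ 'd) pmf" where
  "walk_step \<omega> v = pmf_of_set (neighbours \<omega> v)"

definition path_space :: "(nat \<Rightarrow> int ^ 'd::finite) measure" where
  "path_space = PiM UNIV (\<lambda>_. count_space UNIV)"

text \<open>The conditional law of \<open>X\<^sub>n\<close> given \<open>X\<^sub>0, \<dots>, X\<^bsub>n-1\<^esub>\<close>.\<close>

definition walk_kernel ::
    "'d::finite config \<Rightarrow> nat \<Rightarrow> (nat \<Rightarrow> int ^ 'd) \<Rightarrow> (int ^ 'd) measure" where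
  "walk_kernel \<omega> n X =
     (if n = 0 then measure_pmf (return_pmf 0) else measure_pmf (walk_step \<omega> (X (n - 1))))"

text \<open>
  The law of the Markov chain started at the origin, given by the Ionescu-Tulcea theorem;
  lemma \<open>quenched_law_cylinder\<close> below computes its finite-dimensional distributions.
\<close>

definition quenched_law :: "'d::finite config \<Rightarrow> (nat \<Rightarrow> int ^ 'd) measure" where
  "quenched_law \<omega> =
     projective_family.lim UNIV
       (Ionescu_Tulcea.CI (walk_kernel \<omega>) (\<lambda>_. count_space UNIV)) (\<lambda>_. count_space UNIV)"

text \<open>The mixture of the laws \<open>quenched_law \<omega>\<close>; see lemma \<open>emeasure_annealed_law\<close>.\<close>

definition annealed_law :: "'d::finite config measure \<Rightarrow> (nat \<Rightarrow> int ^ 'd) measure" where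
  "annealed_law Q = conditioned Q \<bind> quenched_law"


section \<open>Basic properties of the walk\<close>

lemma finite_directions: "finite directions"
  by (simp add: directions_def)

lemma directions_nonempty: "directions \<noteq> {}"
  by (simp add: directions_def)

lemma axis_neq_minus_axis: "axis i (1::int) \<noteq> - axis j 1"
proof
  assume "axis i (1::int) = - axis j 1"
  then have "axis i (1::int) $ i = (- axis j 1) $ i" by simp
  then show False by (simp add: axis_def split: if_splits)
qed

lemma card_directions: "card (directions :: (int ^ 'd::finite) set) = 2 * CARD('d)"
proof -
  have "inj (\<lambda>i::'d. axis i (1::int))" "inj (\<lambda>i::'d. - axis i (1::int))"
    by (auto simp: inj_def axis_eq_axis)
  moreover have "range (\<lambda>i::'d. axis i (1::int)) \<inter> range (\<lambda>i. - axis i 1) = {}"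
    using axis_neq_minus_axis by auto
  ultimately show ?thesis
    by (simp add: directions_def card_Un_disjoint card_image)
qed

lemma direction_multiple_eq:
  fixes e e' :: "int ^ 'd::finite"
  assumes "e \<in> directions" "e' \<in> directions" "0 < k" "0 < l" "int k *s e = int l *s e'"
  shows "e = e'"
proof -
  have "\<exists>i. \<exists>s\<in>{1,-1}. e = axis i s" "\<exists>i. \<exists>s\<in>{1,-1}. e' = axis i s"
    using assms(1,2) by (auto simp: directions_def vec_eq_iff axis_def)
  then obtain i s j t where *: "e = axis i s" "e' = axis j t" "s \<in> {1,-1}" "t \<in> {1,-1}" by blast
  have "int k * e $ i = int l * e' $ i"
    using assms(5) by (simp add: vec_eq_iff)
  with * assms(3,4) have "i = j \<and> s = t"
    by (auto simp: axis_def split: if_splits)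
  with * show ?thesis by simp
qed

lemma neighbours_eq_image:
  "neighbours \<omega> v = (\<lambda>e. v + int (first_point e (lattice_shift v \<omega>)) *s e) ` directions"
  by (auto simp: neighbours_def)

lemma finite_neighbours: "finite (neighbours \<omega> v)"
  by (simp add: neighbours_eq_image finite_directions)

lemma neighbours_nonempty: "neighbours \<omega> v \<noteq> {}"
  by (simp add: neighbours_eq_image directions_nonempty)

lemma card_neighbours:
  fixes v :: "int ^ 'd::finite"
  assumes "\<And>e. e \<in> directions \<Longrightarrow> \<exists>k>0. \<omega> (v + int k *s e)"
  shows "card (neighbours \<omega> v) = 2 * CARD('d)"
proof -
  have pos: "0 < first_point e (lattice_shift v \<omega>)" if e: "e \<in> directions" for e
  proof -
    obtain k where "0 < k \<and> lattice_shift v \<omega> (int k *s e)"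
      using assms[OF e] by (auto simp: lattice_shift_def)
    then show ?thesis unfolding first_point_def by (metis (mono_tags, lifting) LeastI)
  qed
  have "inj_on (\<lambda>e. v + int (first_point e (lattice_shift v \<omega>)) *s e) directions"
    by (rule inj_onI) (auto intro: direction_multiple_eq pos)
  then show ?thesis
    by (simp add: neighbours_eq_image card_image card_directions)
qed

lemma pmf_walk_step:
  fixes v :: "int ^ 'd::finite"
  assumes "\<And>e. e \<in> directions \<Longrightarrow> \<exists>k>0. \<omega> (v + int k *s e)"
  shows "pmf (walk_step \<omega> v) u = (if u \<in> neighbours \<omega> v then 1 / (2 * real CARD('d)) else 0)"
  by (simp add: walk_step_def pmf_of_set finite_neighbours neighbours_nonempty
      card_neighbours[OF assms])

lemma space_path_space [simp]: "space path_space = UNIV"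
  by (simp add: path_space_def space_PiM)

lemma walk_kernel_Ionescu_Tulcea:
  fixes \<omega> :: "'d::finite config"
  shows "Ionescu_Tulcea (walk_kernel \<omega>) (\<lambda>_. count_space UNIV)"
proof (rule Ionescu_Tulcea.intro)
  fix n :: nat
  have pmf: "measure_pmf p \<in> space (subprob_algebra (count_space UNIV))" for p :: "(int ^ 'd) pmf"
    by (simp add: space_subprob_algebra measure_pmf.subprob_space_axioms)
  show "walk_kernel \<omega> n \<in>
          PiM {0..<n} (\<lambda>_. count_space UNIV) \<rightarrow>\<^sub>M subprob_algebra (count_space UNIV)"
  proof (cases "n = 0")
    case True
    then have "walk_kernel \<omega> n = (\<lambda>_. measure_pmf (return_pmf 0))"
      by (simp add: walk_kernel_def fun_eq_iff)
    then show ?thesis by (simp only:) (rule measurable_const[OF pmf])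
  next
    case False
    have "(\<lambda>X. X (n - 1)) \<in> PiM {0..<n} (\<lambda>_. count_space (UNIV :: (int ^ 'd) set))
            \<rightarrow>\<^sub>M count_space UNIV"
      using False by (intro measurable_component_singleton) auto
    moreover have "(\<lambda>v. measure_pmf (walk_step \<omega> v)) \<in>
        count_space UNIV \<rightarrow>\<^sub>M subprob_algebra (count_space UNIV)"
      using pmf by (simp only: measurable_count_space_eq1) blast
    ultimately have "(\<lambda>X. measure_pmf (walk_step \<omega> (X (n - 1)))) \<in>
        PiM {0..<n} (\<lambda>_. count_space UNIV) \<rightarrow>\<^sub>M subprob_algebra (count_space UNIV)"
      by (rule measurable_compose)
    moreover have "walk_kernel \<omega> n = (\<lambda>X. measure_pmf (walk_step \<omega> (X (n - 1))))"
      using False by (simp add: walk_kernel_def fun_eq_iff)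
    ultimately show ?thesis by (simp only:)
  qed
next
  fix n :: nat and X :: "nat \<Rightarrow> int ^ 'd"
  assume "X \<in> space (PiM {0..<n} (\<lambda>_. count_space UNIV))"
  show "prob_space (walk_kernel \<omega> n X)"
    by (simp add: walk_kernel_def measure_pmf.prob_space_axioms)
qed

lemma sets_quenched_law [measurable_cong, simp]: "sets (quenched_law \<omega>) = sets path_space"
proof -
  interpret Ionescu_Tulcea "walk_kernel \<omega>" "\<lambda>_. count_space UNIV"
    by (rule walk_kernel_Ionescu_Tulcea)
  show ?thesis by (simp add: quenched_law_def path_space_def PF.sets_lim)
qed

lemma space_quenched_law [simp]: "space (quenched_law \<omega>) = UNIV"
  using sets_eq_imp_space_eq[OF sets_quenched_law] by simp

lemma prob_space_quenched_law: "prob_space (quenched_law \<omega>)"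
proof -
  interpret Ionescu_Tulcea "walk_kernel \<omega>" "\<lambda>_. count_space UNIV"
    by (rule walk_kernel_Ionescu_Tulcea)
  have "prob_space (distr (quenched_law \<omega>) (PiM {} (\<lambda>_. count_space UNIV)) (\<lambda>x. restrict x {}))"
    unfolding quenched_law_def using PF.prob_space_P[of "{}"] by (subst distr_lim) auto
  then show ?thesis
    by (rule prob_space_distrD[rotated])
       (auto simp: path_space_def measurable_cong_sets[OF sets_quenched_law refl]
          intro!: measurable_restrict)
qed

lemma singleton_in_sets_PiM:
  fixes x :: "nat \<Rightarrow> 'a::countable"
  assumes "x \<in> extensional {0..<n}"
  shows "{x} \<in> sets (PiM {0..<n} (\<lambda>_. count_space UNIV))"
proof -
  have "{x} = PiE {0..<n} (\<lambda>i. {x i})"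
    using assms by (simp add: PiE_singleton)
  then show ?thesis by (simp add: sets_PiM_I_finite)
qed

lemma quenched_law_cylinder:
  "measure (quenched_law \<omega>) {X. \<forall>i\<le>n. X i = x i} =
     (if x 0 = 0 then \<Prod>i<n. pmf (walk_step \<omega> (x i)) (x (Suc i)) else 0)"
proof -
  interpret Ionescu_Tulcea "walk_kernel \<omega>" "\<lambda>_. count_space UNIV"
    by (rule walk_kernel_Ionescu_Tulcea)
  let ?r = "\<lambda>n. restrict x {0..<n}"
  let ?M = "\<lambda>n. PiM {0..<n} (\<lambda>_. count_space (UNIV :: (int ^ 'a) set))"
  have [measurable]: "{?r m} \<in> sets (?M m)" for m
    by (rule singleton_in_sets_PiM) auto
  have step: "emeasure (C 0 (Suc m) (\<lambda>_. undefined)) {?r (Suc m)} =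
      emeasure (C 0 m (\<lambda>_. undefined)) {?r m} * emeasure (walk_kernel \<omega> m (?r m)) {x m}" for m
  proof -
    have sp: "space (C 0 m (\<lambda>_. undefined)) = space (?M m)"
      using space_C[of "\<lambda>_. undefined" 0 m] by (simp add: space_PiM)
    have st: "sets (C 0 m (\<lambda>_. undefined)) = sets (?M m)"
      using sets_C[of "\<lambda>_. undefined" 0 m] by (simp add: space_PiM)
    have ne: "space (?M m) \<noteq> {}" by (simp add: space_PiM PiE_eq_empty_iff)
    have "emeasure (C 0 (Suc m) (\<lambda>_. undefined)) {?r (Suc m)} =
        (\<integral>\<^sup>+y. emeasure (eP m y) {?r (Suc m)} \<partial>C 0 m (\<lambda>_. undefined))"
      using measurable_eP[of m] ne
      by (simp, subst emeasure_bind[where N = "?M (Suc m)"])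
         (auto simp: sp measurable_cong_sets[OF st refl])
    also have "\<dots> = (\<integral>\<^sup>+y. emeasure (walk_kernel \<omega> m (?r m)) {x m} * indicator {?r m} y
                      \<partial>C 0 m (\<lambda>_. undefined))"
    proof (rule nn_integral_cong)
      fix y assume "y \<in> space (C 0 m (\<lambda>_. undefined))"
      then have y: "y \<in> space (?M m)" by (simp add: sp)
      then have ext: "y \<in> extensional {0..<m}" by (simp add: space_PiM PiE_iff)
      have upd: "y(m := z) = ?r (Suc m) \<longleftrightarrow> y = ?r m \<and> z = x m" for z
      proof
        assume h: "y(m := z) = ?r (Suc m)"
        have "y k = ?r m k" for k
          using fun_cong[OF h, of k] ext by (cases "k < m") (auto simp: extensional_def)
        moreover have "z = x m" using fun_cong[OF h, of m] by simp
        ultimately show "y = ?r m \<and> z = x m" by blast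
      next
        assume h: "y = ?r m \<and> z = x m"
        then show "y(m := z) = ?r (Suc m)"
          by (auto simp: fun_eq_iff restrict_def)
      qed
      have "emeasure (eP m y) {?r (Suc m)} =
          emeasure (walk_kernel \<omega> m y) {z. y(m := z) = ?r (Suc m)}"
        by (subst emeasure_eP[OF y]) (auto simp: vimage_def)
      also have "{z. y(m := z) = ?r (Suc m)} = (if y = ?r m then {x m} else {})"
        by (auto simp: upd)
      finally show "emeasure (eP m y) {?r (Suc m)} =
          emeasure (walk_kernel \<omega> m (?r m)) {x m} * indicator {?r m} y"
        by (cases "y = ?r m") (simp_all del: restrict_apply add: indicator_def)
    qed
    also have "\<dots> = emeasure (C 0 m (\<lambda>_. undefined)) {?r m} * emeasure (walk_kernel \<omega> m (?r m)) {x m}"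
      by (subst nn_integral_cmult_indicator) (auto simp: st mult.commute)
    finally show ?thesis .
  qed
  have C: "emeasure (C 0 (Suc n) (\<lambda>_. undefined)) {?r (Suc n)} =
      ennreal (if x 0 = 0 then \<Prod>i<n. pmf (walk_step \<omega> (x i)) (x (Suc i)) else 0)"
  proof (induction n)
    case 0
    have "?r 0 = (\<lambda>_. undefined)" by auto
    then have "emeasure (C 0 0 (\<lambda>_. undefined)) {?r 0} = 1"
      by (simp add: PiM_empty)
    then show ?case
      by (subst step) (auto simp: walk_kernel_def emeasure_pmf_single)
  next
    case (Suc n)
    have "emeasure (walk_kernel \<omega> (Suc n) (?r (Suc n))) {x (Suc n)} =
        ennreal (pmf (walk_step \<omega> (x n)) (x (Suc n)))"
      by (simp add: walk_kernel_def emeasure_pmf_single)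
    then show ?case
      by (subst step, subst Suc.IH) (auto simp: ennreal_mult[symmetric] prod_nonneg)
  qed
  have "{X. \<forall>i\<le>n. X i = x i} = PF.emb UNIV {0..<Suc n} {?r (Suc n)}"
  proof (intro set_eqI iffI)
    fix X assume "X \<in> {X. \<forall>i\<le>n. X i = x i}"
    then have "restrict X {0..<Suc n} = ?r (Suc n)" by (intro restrict_ext) auto
    then show "X \<in> PF.emb UNIV {0..<Suc n} {?r (Suc n)}" by (simp add: prod_emb_iff)
  next
    fix X assume "X \<in> PF.emb UNIV {0..<Suc n} {?r (Suc n)}"
    then have *: "restrict X {0..<Suc n} = ?r (Suc n)" by (simp add: prod_emb_iff)
    have "X i = x i" if "i \<le> n" for i
      using fun_cong[OF *, of i] that by (simp add: less_Suc_eq_le)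
    then show "X \<in> {X. \<forall>i\<le>n. X i = x i}" by simp
  qed
  then have "emeasure (quenched_law \<omega>) {X. \<forall>i\<le>n. X i = x i} =
      emeasure (CI {0..<Suc n}) {?r (Suc n)}"
    unfolding quenched_law_def by (simp only:, subst lim) auto
  also have "\<dots> = emeasure (C 0 (Suc n) (\<lambda>_. undefined))
                  (PF.emb {0..<Suc n} {0..<Suc n} {?r (Suc n)})"
    by (rule emeasure_CI) auto
  also have "PF.emb {0..<Suc n} {0..<Suc n} {?r (Suc n)} = {?r (Suc n)}"
    by (rule prod_emb_id) (simp add: space_PiM)
  finally show ?thesis
    by (simp del: C.simps add: C measure_def prod_nonneg)
qed

lemma measurable_first_point:
  "first_point e \<in> config_space \<rightarrow>\<^sub>M count_space UNIV"
proof -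
  have [measurable]: "(\<lambda>\<omega>. \<omega> x) \<in> config_space \<rightarrow>\<^sub>M count_space UNIV" for x :: "int ^ 'a"
    unfolding config_space_def by (rule measurable_component_singleton) simp
  show ?thesis
    unfolding first_point_def[abs_def] by measurable
qed

lemma space_config_space [simp]: "space config_space = UNIV"
  by (simp add: config_space_def space_PiM)

lemma measurable_lattice_shift [measurable]: "lattice_shift x \<in> config_space \<rightarrow>\<^sub>M config_space"
  unfolding config_space_def lattice_shift_def[abs_def]
  by (rule measurable_PiM_single') (auto simp: space_PiM intro: measurable_component_singleton)

lemma measurable_pmf_walk_step [measurable]:
  fixes v u :: "int ^ 'd::finite"
  shows "(\<lambda>\<omega>. pmf (walk_step \<omega> v) u) \<in> borel_measurable config_space"
proof -
  have fp [measurable]: "(\<lambda>\<omega>. first_point e (lattice_shift v \<omega>)) \<in> config_space \<rightarrow>\<^sub>M count_space UNIV" for e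
    by (rule measurable_compose[OF measurable_lattice_shift measurable_first_point])
  note [measurable] = countable_finite[OF finite_directions]
  have N: "(\<lambda>\<omega>. neighbours \<omega> v) \<in> config_space \<rightarrow>\<^sub>M count_space (Collect finite)"
  proof (subst measurable_count_space_eq_countable)
    show "countable (Collect finite :: (int ^ 'd) set set)"
      by (rule countable_Collect_finite)
    have "Measurable.pred config_space (\<lambda>\<omega>. neighbours \<omega> v = S)" if "finite S" for S
    proof -
      have *: "neighbours \<omega> v = S \<longleftrightarrow>
          (\<forall>e\<in>directions. v + int (first_point e (lattice_shift v \<omega>)) *s e \<in> S) \<and>
          (\<forall>s\<in>S. \<exists>e\<in>directions. s = v + int (first_point e (lattice_shift v \<omega>)) *s e)" for \<omega>
        by (auto simp: neighbours_eq_image)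
      have "Measurable.pred config_space (\<lambda>\<omega>. A (first_point e (lattice_shift v \<omega>)))" for A e
        by (rule measurable_compose[OF fp]) simp
      then show ?thesis
        unfolding * using that finite_directions
        by (intro pred_intros_logic pred_intros_finite) auto
    qed
    then show "(\<lambda>\<omega>. neighbours \<omega> v) \<in> space config_space \<rightarrow> Collect finite \<and>
        (\<forall>S\<in>Collect finite. (\<lambda>\<omega>. neighbours \<omega> v) -` {S} \<inter> space config_space \<in> sets config_space)"
      by (auto simp: finite_neighbours pred_def vimage_def)
  qed
  show ?thesis
    unfolding walk_step_def
    by (rule measurable_compose[OF N]) simp
qed

lemma measurable_quenched_law [measurable]:
  "quenched_law \<in> config_space \<rightarrow>\<^sub>M prob_algebra (path_space :: (nat \<Rightarrow> int ^ 'd::finite) measure)"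
proof -
  let ?cyl = "\<lambda>n (x :: nat \<Rightarrow> int ^ 'd). {X. \<forall>i\<le>n. X i = x i}"
  let ?G = "insert {} {?cyl n x | n x. True}"
  have single: "(\<lambda>X. X i) \<in> path_space \<rightarrow>\<^sub>M count_space (UNIV :: (int ^ 'd) set)" for i
    unfolding path_space_def by (rule measurable_component_singleton) simp
  have cyl: "?cyl n x \<in> sets path_space" for n x
  proof -
    have "Measurable.pred path_space (\<lambda>X. \<forall>i\<in>{..n}. X i = x i)"
      using single by (intro pred_intros_finite) (auto intro: measurable_compose[OF single])
    then show ?thesis by (simp add: pred_def Ball_def)
  qed
  have sing: "{X. X i = a} \<in> sigma_sets UNIV ?G" for i and a :: "int ^ 'd"
  proof -
    define D where "D = {?cyl i (\<lambda>j. if j \<le> i then xs ! j else 0) | xs. xs ! i = a}"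
    have "countable D"
    proof -
      have "D \<subseteq> range (\<lambda>xs. ?cyl i (\<lambda>j. if j \<le> i then xs ! j else 0))" by (auto simp: D_def)
      then show ?thesis by (rule countable_subset) auto
    qed
    moreover have "D \<subseteq> sigma_sets UNIV ?G" by (auto simp: D_def intro!: sigma_sets.Basic)
    ultimately have "\<Union>D \<in> sigma_sets UNIV ?G" 
      by (intro sigma_algebra.countable_Union[OF sigma_algebra_sigma_sets]) auto
    also have "\<Union>D = {X. X i = a}"
    proof (intro set_eqI iffI)
      fix X assume "X \<in> {X. X i = a}"
      then have "X \<in> ?cyl i (\<lambda>j. if j \<le> i then map X [0..<Suc i] ! j else 0)"
        "map X [0..<Suc i] ! i = a"
        by (auto simp del: upt_Suc)
      then show "X \<in> \<Union>D" unfolding D_def by blast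
    qed (auto simp: D_def)
    finally show ?thesis .
  qed
  have sets: "sets path_space = sigma_sets UNIV ?G"
  proof
    show "sigma_sets UNIV ?G \<subseteq> sets path_space"
      using sets.sigma_sets_subset[of ?G path_space] cyl by auto
    have "(\<lambda>X. X) \<in> sigma UNIV ?G \<rightarrow>\<^sub>M path_space"
      unfolding path_space_def
    proof (rule measurable_PiM_single')
      fix i
      show "(\<lambda>X. X i) \<in> sigma UNIV ?G \<rightarrow>\<^sub>M count_space (UNIV :: (int ^ 'd) set)"
        using sing
        by (subst measurable_count_space_eq_countable) (auto simp: vimage_def)
    qed (auto)
    then show "sets path_space \<subseteq> sigma_sets UNIV ?G"
      by (auto dest: measurable_sets)
  qed
  show ?thesis
  proof (rule measurable_prob_algebra_generated[OF sets])
    show "Int_stable ?G"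
    proof (rule Int_stableI)
      have *: "?cyl n x \<inter> ?cyl m y \<in> ?G" if "n \<le> m" for n m x y
      proof (cases "\<forall>i\<le>n. x i = y i")
        case True
        then have "?cyl n x \<inter> ?cyl m y = ?cyl m y" using that by (auto)
        then show ?thesis by blast
      next
        case False
        then have "?cyl n x \<inter> ?cyl m y = {}" using that by (auto)
        then show ?thesis by simp
      qed
      fix A B assume "A \<in> ?G" "B \<in> ?G"
      then consider "A = {} \<or> B = {}" | n x m y where "A = ?cyl n x" "B = ?cyl m y" by blast
      then show "A \<inter> B \<in> ?G"
      proof cases
        case 2 then show ?thesis
          using *[of n m x y] *[of m n y x] by (cases "n \<le> m") (simp_all add: Int_commute)
      qed auto
    qed
    fix A assume "A \<in> ?G"
    then show "(\<lambda>\<omega>. emeasure (quenched_law \<omega>) A) \<in> borel_measurable config_space"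
    proof safe
      fix n x
      have eq: "emeasure (quenched_law \<omega>) (?cyl n x) =
        ennreal (if x 0 = 0 then \<Prod>i<n. pmf (walk_step \<omega> (x i)) (x (Suc i)) else 0)" for \<omega>
      proof -
        interpret prob_space "quenched_law \<omega>" by (rule prob_space_quenched_law)
        show ?thesis by (simp add: emeasure_eq_measure quenched_law_cylinder)
      qed
      show "(\<lambda>\<omega>. emeasure (quenched_law \<omega>) (?cyl n x)) \<in> borel_measurable config_space"
        unfolding eq by measurable
    qed simp
  qed (auto simp: prob_space_quenched_law)
qed

lemma sets_conditioned [simp]: "sets (conditioned Q) = sets Q"
  by (simp add: conditioned_def)

lemma sets_annealed_law:
  assumes "sets Q = sets config_space"
  shows "sets (annealed_law Q) = sets path_space"
proof -
  have "space (conditioned Q) \<noteq> {}"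
    using sets_eq_imp_space_eq[of "conditioned Q" config_space] assms by simp
  then show ?thesis unfolding annealed_law_def by (intro sets_bind) auto
qed

lemma emeasure_annealed_law:
  assumes "sets Q = sets config_space" and "A \<in> sets path_space"
  shows "emeasure (annealed_law Q) A = (\<integral>\<^sup>+\<omega>. emeasure (quenched_law \<omega>) A \<partial>conditioned Q)"
proof -
  have "space (conditioned Q) \<noteq> {}"
    using sets_eq_imp_space_eq[of "conditioned Q" config_space] assms by simp
  moreover have "quenched_law \<in> conditioned Q \<rightarrow>\<^sub>M subprob_algebra path_space"
    using measurable_prob_algebraD[OF measurable_quenched_law] assms(1)
    by (simp cong: measurable_cong_sets)
  ultimately show ?thesis
    unfolding annealed_law_def using assms(2) by (intro emeasure_bind)
qed

end

theory Submission
  imports Defs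
begin

text \<open>
  Let \<open>P = Q(\<cdot> | \<Omega>\<^sub>0)\<close>, and let \<open>T\<close> act on pairs (environment, path) by recentring both at
  the position after one step. The first return map \<open>\<sigma>\<^sub>e\<close> from \<open>\<Omega>\<^sub>0\<close> to itself in direction \<open>e\<close>
  preserves \<open>P\<close>, hence \<open>T\<close> preserves the joint law, and \<open>X\<^sub>n\<close> is a Birkhoff sum of the first
  displacement, which is integrable by Kac's lemma. By the ergodic theorem it is enough that the
  displacement has integral zero over every \<open>T\<close>-invariant set \<open>A\<close>. The quenched probability
  \<open>\<phi>(\<omega>)\<close> of the section of \<open>A\<close> at \<open>\<omega>\<close> is a bounded harmonic function of the environment chain,
  which is stationary, so \<open>\<phi> \<circ> \<sigma>\<^sub>e = \<phi>\<close> almost surely. The integral in question is therefore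
  \<open>(2d)\<^sup>-\<^sup>1 \<Sum>\<^sub>e e \<integral> f\<^sub>e \<phi> dP\<close>; it vanishes because \<open>f\<^bsub>-e\<^esub> \<circ> \<sigma>\<^sub>e = f\<^sub>e\<close> gives
  \<open>\<integral> f\<^bsub>-e\<^esub> \<phi> dP = \<integral> f\<^sub>e \<phi> dP\<close>.
\<close>

section \<open>The ergodic theorem\<close>

locale measure_preserving = prob_space M for M :: "'a measure" +
  fixes T :: "'a \<Rightarrow> 'a"
  assumes T_meas [measurable]: "T \<in> M \<rightarrow>\<^sub>M M"
    and distr_T: "distr M M T = M"
begin

lemma funpow_T_meas [measurable]: "(T ^^ k) \<in> M \<rightarrow>\<^sub>M M"
  by (induction k) (auto intro: measurable_comp)

lemma integrable_T:
  fixes f :: "'a \<Rightarrow> real"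
  assumes "integrable M f"
  shows "integrable M (\<lambda>x. f (T x))"
  by (rule integrable_distr[OF T_meas]) (simp add: distr_T assms)

lemma integral_T:
  fixes f :: "'a \<Rightarrow> real"
  assumes "f \<in> borel_measurable M"
  shows "(\<integral>x. f (T x) \<partial>M) = (\<integral>x. f x \<partial>M)"
  by (metis assms T_meas distr_T integral_distr)

definition birkhoff_sum :: "('a \<Rightarrow> real) \<Rightarrow> nat \<Rightarrow> 'a \<Rightarrow> real" where
  "birkhoff_sum f n x = (\<Sum>k<n. f ((T ^^ k) x))"

lemma birkhoff_sum_Suc: "birkhoff_sum f (Suc n) x = f x + birkhoff_sum f n (T x)"
  by (simp add: birkhoff_sum_def sum.lessThan_Suc_shift funpow_swap1 del: sum.lessThan_Suc)

lemma birkhoff_sum_measurable [measurable]: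
  assumes [measurable]: "f \<in> borel_measurable M"
  shows "birkhoff_sum f n \<in> borel_measurable M"
  unfolding birkhoff_sum_def[abs_def] by measurable

text \<open>The maximum of the Birkhoff sums of orders 0 to n, order 0 contributing the value 0. The
  recursion splits off the first point of the orbit and so ties stage n + 1 to stage n after
  \<open>T\<close>.\<close>

primrec maximal_sum :: "('a \<Rightarrow> real) \<Rightarrow> nat \<Rightarrow> 'a \<Rightarrow> real" where
  "maximal_sum f 0 x = 0"
| "maximal_sum f (Suc n) x = max 0 (f x + maximal_sum f n (T x))"

lemma maximal_sum_nonneg: "0 \<le> maximal_sum f n x"
  by (cases n) auto

lemma maximal_sum_mono: "maximal_sum f n x \<le> maximal_sum f (Suc n) x"
proof (induction n arbitrary: x)
  case (Suc n)
  then show ?case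
    unfolding maximal_sum.simps(2)[of f _ x] by (intro max.mono add_left_mono) simp_all
qed simp

lemma birkhoff_sum_le_maximal_sum: "birkhoff_sum f n x \<le> maximal_sum f n x"
proof (induction n arbitrary: x)
  case (Suc n)
  then show ?case by (simp add: birkhoff_sum_Suc max_def) (smt (verit) Suc)
qed (simp add: birkhoff_sum_def)

lemma integrable_maximal_sum:
  assumes "integrable M f"
  shows "integrable M (maximal_sum f n)"
proof (induction n)
  case (Suc n)
  have "integrable M (\<lambda>x. max 0 (f x + maximal_sum f n (T x)))"
    using assms integrable_T[OF Suc] by (intro integrable_max) auto
  then show ?case by (simp cong: integrable_cong)
qed (simp cong: integrable_cong)

text \<open>Garsia's argument: where the maximal sum at stage \<open>n + 1\<close> is positive it equals \<open>f\<close> plus the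
  maximal sum at stage \<open>n\<close> composed with \<open>T\<close>.\<close>

lemma maximal_ergodic:
  assumes f: "integrable M f"
    and A: "A \<in> sets M"
    and le: "\<And>x n. x \<in> space M \<Longrightarrow> 0 < maximal_sum f n x \<Longrightarrow> x \<in> A"
    and ge: "\<And>x. x \<in> A \<Longrightarrow> \<exists>n. 0 < maximal_sum f n x"
  shows "0 \<le> (\<integral>x. f x * indicator A x \<partial>M)"
proof (rule LIMSEQ_le_const)
  let ?D = "\<lambda>n. {x \<in> space M. 0 < maximal_sum f n x}"
  note [measurable] = borel_measurable_integrable[OF f] borel_measurable_integrable[OF integrable_maximal_sum[OF f]] A
  \<comment> \<open>By \<open>le\<close> and \<open>ge\<close> the sets \<open>?D n\<close> increase
    to \<open>A\<close>, so the inequality over each \<open>?D n\<close> passes to the limit by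
    dominated convergence.\<close>
  show "(\<lambda>n. \<integral>x. f x * indicator (?D n) x \<partial>M) \<longlonglongrightarrow> (\<integral>x. f x * indicator A x \<partial>M)"
  proof (rule integral_dominated_convergence[where w = "\<lambda>x. \<bar>f x\<bar>"])
    show "AE x in M. (\<lambda>n. f x * indicator (?D n) x) \<longlonglongrightarrow> f x * indicator A x"
    proof (rule AE_I2)
      fix x assume x: "x \<in> space M"
      have "\<forall>\<^sub>F n in sequentially. f x * indicator (?D n) x = f x * indicator A x"
      proof (cases "x \<in> A")
        case True
        then obtain m where "0 < maximal_sum f m x" using ge by blast
        then have "0 < maximal_sum f n x" if "m \<le> n" for n
          using lift_Suc_mono_le[of "\<lambda>n. maximal_sum f n x" m n, OF maximal_sum_mono that] by simp
        then show ?thesis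
          using True x by (intro eventually_sequentiallyI[of m]) auto
      next
        case False
        then have "x \<notin> ?D n" for n using le[OF x] by blast
        then show ?thesis using False by simp
      qed
      then show "(\<lambda>n. f x * indicator (?D n) x) \<longlonglongrightarrow> f x * indicator A x"
        by (rule tendsto_eventually)
    qed
  qed (use f in \<open>auto simp: indicator_def intro!: integrable_abs\<close>)
  \<comment> \<open>Garsia's comparison needs a preceding stage m with n = Suc m, hence 1 \<le>
    n.\<close>
  have "0 \<le> (\<integral>x. f x * indicator (?D n) x \<partial>M)" if pos: "1 \<le> n" for n
  proof -
    obtain m where n: "n = Suc m" using pos by (cases n) auto
    have int: "integrable M (\<lambda>x. maximal_sum f m (T x))"
      by (rule integrable_T[OF integrable_maximal_sum[OF f]])
    \<comment> \<open>Maximal sums grow with the stage; invariance of \<open>M\<close> then replaces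
      the stage m integrand by its composition with \<open>T\<close>.\<close>
    have "0 \<le> (\<integral>x. maximal_sum f n x \<partial>M) - (\<integral>x. maximal_sum f m x \<partial>M)"
      using maximal_sum_mono[of f m] by (simp add: n integral_mono integrable_maximal_sum[OF f] del: maximal_sum.simps)
    also have "\<dots> = (\<integral>x. maximal_sum f n x - maximal_sum f m (T x) \<partial>M)"
      by (subst Bochner_Integration.integral_diff)
         (auto intro: integrable_maximal_sum f int simp: integral_T)
    also have "\<dots> \<le> (\<integral>x. f x * indicator (?D n) x \<partial>M)"
    proof (rule integral_mono)
      show "integrable M (\<lambda>x. f x * indicator (?D n) x)"
        using f by (intro integrable_real_mult_indicator) auto
      \<comment> \<open>Equality holds on \<open>?D n\<close>; off it the stage n maximum is 0 and
        the subtracted term is nonnegative.\<close>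
      show "maximal_sum f n x - maximal_sum f m (T x) \<le> f x * indicator (?D n) x"
        if "x \<in> space M" for x
        using that maximal_sum_nonneg[of f m "T x"] by (auto simp: n indicator_def max_def)
    qed (intro Bochner_Integration.integrable_diff integrable_maximal_sum f int)
    finally show ?thesis .
  qed
  then show "\<exists>N. \<forall>n\<ge>N. 0 \<le> (\<integral>x. f x * indicator (?D n) x \<partial>M)" by blast
qed

text \<open>On the invariant set \<open>A\<close> where every such bound fails, the maximal
  inequality for f - \<epsilon> shows that the integral of f over \<open>A\<close> is at least
  \<epsilon> times the measure of \<open>A\<close>. That integral is 0 by hypothesis, so
  \<open>A\<close> is null.\<close>

lemma birkhoff_sum_bounded_above:
  assumes f: "integrable M f" and \<epsilon>: "0 < \<epsilon>"
    and zero: "\<And>A. A \<in> sets M \<Longrightarrow> T -` A \<inter> space M = A \<Longrightarrow> (\<integral>x. f x * indicator A x \<partial>M) = 0"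
  shows "AE x in M. \<exists>C. \<forall>n. birkhoff_sum f n x \<le> \<epsilon> * real n + real C"
proof -
  \<comment> \<open>The free constant C makes \<open>A\<close> exactly invariant: one step along the
    orbit changes the sum by f x and the bound by \<epsilon>, and C absorbs both. Natural values of
    C keep \<open>A\<close> measurable.\<close>
  define A where "A = {x \<in> space M. \<forall>C::nat. \<exists>n. \<epsilon> * real n + real C < birkhoff_sum f n x}"
  note [measurable] = borel_measurable_integrable[OF f]
  have [measurable]: "A \<in> sets M" unfolding A_def by measurable
  have T_iff: "T x \<in> A \<longleftrightarrow> x \<in> A" if x: "x \<in> space M" for x
  proof -
    have Tx: "T x \<in> space M" using x T_meas by (rule measurable_space[rotated])
    show ?thesis
    proof
      assume "T x \<in> A"
      then have *: "\<exists>n. \<epsilon> * real n + real C < birkhoff_sum f n (T x)" for C by (simp add: A_def)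
      have "\<exists>n. \<epsilon> * real n + real C < birkhoff_sum f n x" for C
      proof -
        obtain D where D: "real C + \<epsilon> - f x < real D" using reals_Archimedean2 by blast
        obtain n where n: "\<epsilon> * real n + real D < birkhoff_sum f n (T x)" using * by blast
        have "\<epsilon> * real (Suc n) + real C < birkhoff_sum f (Suc n) x"
          using n D by (simp add: birkhoff_sum_Suc distrib_left)
        then show ?thesis by blast
      qed
      with x show "x \<in> A" by (simp add: A_def)
    next
      assume "x \<in> A"
      then have *: "\<exists>n. \<epsilon> * real n + real C < birkhoff_sum f n x" for C by (simp add: A_def)
      have "\<exists>n. \<epsilon> * real n + real C < birkhoff_sum f n (T x)" for C
      proof -
        obtain D where D: "real C - \<epsilon> + f x < real D" using reals_Archimedean2 by blast
        obtain n where n: "\<epsilon> * real n + real D < birkhoff_sum f n x" using * by blast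
        show ?thesis
        proof (cases n)
          \<comment> \<open>Impossible: the empty sum 0 does not exceed the nonnegative
            \<open>real D\<close>.\<close>
          case 0
          then show ?thesis using n by (simp add: birkhoff_sum_def)
        next
          case (Suc m)
          then show ?thesis
            using n D by (intro exI[of _ m]) (simp add: birkhoff_sum_Suc distrib_left)
        qed
      qed
      with Tx show "T x \<in> A" by (simp add: A_def)
    qed
  qed
  \<comment> \<open>Orbits never cross the boundary of the invariant set \<open>A\<close>: off
    \<open>A\<close> the maximal sums of g vanish, and on \<open>A\<close> its Birkhoff sums are
    those of f minus \<epsilon> n. Hence some maximal sum of g is positive exactly on
    \<open>A\<close>.\<close>
  define g where "g x = (f x - \<epsilon>) * indicator A x" for x
  have g: "integrable M g"
    unfolding g_def[abs_def] using f by (intro integrable_real_mult_indicator) auto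
  have sp: "T x \<in> space M" if "x \<in> space M" for x
    using that T_meas by (rule measurable_space[rotated])
  have sum_g: "birkhoff_sum g n x = birkhoff_sum f n x - \<epsilon> * real n" if "x \<in> A" for n x
    using that
  proof (induction n arbitrary: x)
    case (Suc n)
    have "x \<in> space M" using Suc.prems by (simp add: A_def)
    with Suc show ?case by (simp add: birkhoff_sum_Suc g_def T_iff distrib_left)
  qed (simp add: birkhoff_sum_def)
  have max_g: "maximal_sum g n x = 0" if "x \<in> space M" "x \<notin> A" for n x
    using that
  proof (induction n arbitrary: x)
    case (Suc n)
    then show ?case by (simp add: g_def T_iff sp)
  qed simp
  have "0 \<le> (\<integral>x. g x * indicator A x \<partial>M)"
  proof (rule maximal_ergodic[OF g])
    fix x assume x: "x \<in> A"
    then have "\<exists>n. \<epsilon> * real n + real 0 < birkhoff_sum f n x" unfolding A_def by blast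
    then obtain n where "\<epsilon> * real n + real 0 < birkhoff_sum f n x" ..
    then have "0 < birkhoff_sum g n x" using sum_g[OF x] by simp
    then show "\<exists>n. 0 < maximal_sum g n x"
      using birkhoff_sum_le_maximal_sum less_le_trans by blast
  next
    fix x n assume "x \<in> space M" "0 < maximal_sum g n x"
    then show "x \<in> A" using max_g[of x n] by auto
  qed simp
  also have "(\<lambda>x. g x * indicator A x) = (\<lambda>x. f x * indicator A x - \<epsilon> * indicator A x)"
    by (auto simp: g_def indicator_def)
  also have "(\<integral>x. f x * indicator A x - \<epsilon> * indicator A x \<partial>M) =
      (\<integral>x. f x * indicator A x \<partial>M) - (\<integral>x. \<epsilon> * indicator A x \<partial>M)"
    using f by (intro Bochner_Integration.integral_diff integrable_real_mult_indicator) auto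
  also have "\<dots> = - \<epsilon> * measure M A"
  proof -
    have "T -` A \<inter> space M = A" using T_iff by (auto simp: A_def)
    then show ?thesis using zero[of A] by simp
  qed
  finally have "measure M A = 0"
    using \<epsilon> measure_nonneg[of M A] by (simp add: mult_le_0_iff)
  then have "AE x in M. x \<notin> A"
    by (intro AE_not_in) (simp add: null_sets_def emeasure_eq_measure)
  then show ?thesis
    by (rule AE_mp) (rule AE_I2, auto simp: A_def not_less)
qed

text \<open>The hypothesis \<open>zero\<close> says that f has conditional expectation 0 given the
  invariant sets, and this is the limit in Birkhoff's theorem. The upper bound is applied to f and
  to -f with \<epsilon> = 1 / (j + 1) for every j.\<close>

theorem birkhoff_sum_tendsto_0:
  assumes f: "integrable M f"
    and zero: "\<And>A. A \<in> sets M \<Longrightarrow> T -` A \<inter> space M = A \<Longrightarrow> (\<integral>x. f x * indicator A x \<partial>M) = 0"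
  shows "AE x in M. (\<lambda>n. birkhoff_sum f n x / real n) \<longlonglongrightarrow> 0"
proof -
  have minus: "birkhoff_sum (\<lambda>x. - f x) n x = - birkhoff_sum f n x" for n x
    by (simp add: birkhoff_sum_def sum_negf)
  have "AE x in M. \<forall>j. \<exists>C. \<forall>n. \<bar>birkhoff_sum f n x\<bar> \<le> inverse (real (Suc j)) * real n + real C"
  proof (subst AE_all_countable, rule allI)
    fix j
    have "AE x in M. \<exists>C. \<forall>n. birkhoff_sum f n x \<le> inverse (real (Suc j)) * real n + real C"
      by (rule birkhoff_sum_bounded_above[OF f _ zero]) auto
    moreover
    have "AE x in M. \<exists>C. \<forall>n. birkhoff_sum (\<lambda>x. - f x) n x \<le> inverse (real (Suc j)) * real n + real C"
      by (rule birkhoff_sum_bounded_above) (use f zero in auto)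
    ultimately show "AE x in M. \<exists>C. \<forall>n. \<bar>birkhoff_sum f n x\<bar> \<le> inverse (real (Suc j)) * real n + real C"
    proof (rule AE_mp[OF AE_conjI], intro AE_I2 impI)
      fix x
      assume "(\<exists>C. \<forall>n. birkhoff_sum f n x \<le> inverse (real (Suc j)) * real n + real C) \<and>
        (\<exists>C. \<forall>n. birkhoff_sum (\<lambda>x. - f x) n x \<le> inverse (real (Suc j)) * real n + real C)"
      then obtain C D where
        "\<And>n. birkhoff_sum f n x \<le> inverse (real (Suc j)) * real n + real C"
        "\<And>n. - birkhoff_sum f n x \<le> inverse (real (Suc j)) * real n + real D"
        unfolding minus by blast
      then have "\<bar>birkhoff_sum f n x\<bar> \<le> inverse (real (Suc j)) * real n + real (max C D)" for n
        by (smt (verit) max.cobounded1 max.cobounded2 of_nat_mono)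
      then show "\<exists>C. \<forall>n. \<bar>birkhoff_sum f n x\<bar> \<le> inverse (real (Suc j)) * real n + real C" by blast
    qed
  qed
  then show ?thesis
  proof (rule AE_mp, intro AE_I2 impI)
    fix x
    assume *: "\<forall>j. \<exists>C. \<forall>n. \<bar>birkhoff_sum f n x\<bar> \<le> inverse (real (Suc j)) * real n + real C"
    show "(\<lambda>n. birkhoff_sum f n x / real n) \<longlonglongrightarrow> 0"
    proof (rule LIMSEQ_I)
      fix r :: real assume r: "0 < r"
      obtain j where j: "inverse (real (Suc j)) < r / 2" using reals_Archimedean[of "r/2"] r by auto
      obtain C where C: "\<And>n. \<bar>birkhoff_sum f n x\<bar> \<le> inverse (real (Suc j)) * real n + real C"
        using * by blast
      \<comment> \<open>Beyond N the constant C contributes less than r / 2 to the average, and the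
        slope contributes less than another r / 2.\<close>
      obtain N where N: "2 * real C / r < real N" using reals_Archimedean2 by blast
      have "norm (birkhoff_sum f n x / real n - 0) < r" if n: "Suc N \<le> n" for n
      proof -
        have pos: "0 < real n" using n by simp
        have "real C < r / 2 * real N" using N r by (simp add: field_simps)
        also have "\<dots> \<le> r / 2 * real n" using n r by simp
        finally have "\<bar>birkhoff_sum f n x\<bar> < r / 2 * real n + r / 2 * real n"
          using C[of n] mult_strict_right_mono[OF j pos] by linarith
        then show ?thesis using pos by (simp add: field_simps)
      qed
      then show "\<exists>N. \<forall>n\<ge>N. norm (birkhoff_sum f n x / real n - 0) < r" by blast
    qed
  qed
qed

end

section \<open>First return maps\<close>

definition has_point :: "int ^ 'd \<Rightarrow> 'd::finite config \<Rightarrow> bool" where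
  "has_point e \<omega> \<longleftrightarrow> (\<exists>k>0. \<omega> (int k *s e))"

text \<open>A relational form of \<open>first_point\<close>, false when no point exists. Fixing the
  gap k turns the random shift in \<open>first_return\<close> into a deterministic one.\<close>

definition first_point_at :: "int ^ 'd \<Rightarrow> nat \<Rightarrow> 'd::finite config \<Rightarrow> bool" where
  "first_point_at e k \<omega> \<longleftrightarrow> 0 < k \<and> \<omega> (int k *s e) \<and> (\<forall>j. 0 < j \<and> j < k \<longrightarrow> \<not> \<omega> (int j *s e))"

text \<open>The map written \<open>\<sigma>\<^sub>e\<close> in the overview: where a point exists,
  the transformation induced on \<open>origin_occupied\<close> by the shift along e.\<close>

definition first_return :: "int ^ 'd \<Rightarrow> 'd::finite config \<Rightarrow> 'd config" where
  "first_return e \<omega> = lattice_shift (int (first_point e \<omega>) *s e) \<omega>"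

lemma lattice_shift_shift: "lattice_shift x (lattice_shift y \<omega>) = lattice_shift (y + x) \<omega>"
  by (simp add: lattice_shift_def add.assoc)

lemma lattice_shift_0 [simp]: "lattice_shift 0 \<omega> = \<omega>"
  by (simp add: lattice_shift_def)

lemma first_point_at_iff: "first_point_at e k \<omega> \<longleftrightarrow> has_point e \<omega> \<and> first_point e \<omega> = k"
proof
  assume "first_point_at e k \<omega>"
  then show "has_point e \<omega> \<and> first_point e \<omega> = k"
    unfolding first_point_at_def first_point_def has_point_def
    by (auto intro!: Least_equality simp: not_less[symmetric])
next
  assume *: "has_point e \<omega> \<and> first_point e \<omega> = k"
  then have "0 < k \<and> \<omega> (int k *s e)"
    unfolding has_point_def first_point_def by (metis (mono_tags, lifting) LeastI)
  then show "first_point_at e k \<omega>"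
    using * not_less_Least[of _ "\<lambda>k. 0 < k \<and> \<omega> (int k *s e)"]
    by (auto simp: first_point_at_def first_point_def)
qed

text \<open>Seen from the point \<open>int k *s e\<close>, the site at distance j in direction -e is
  the site at distance k - j from the origin in direction e. A gap between consecutive points
  therefore has the same length from both ends.\<close>

lemma first_point_at_reverse:
  assumes "\<omega> 0" "first_point_at e k \<omega>"
  shows "lattice_shift (int k *s e) \<omega> 0" "first_point_at (- e) k (lattice_shift (int k *s e) \<omega>)"
proof -
  show "lattice_shift (int k *s e) \<omega> 0"
    using assms by (simp add: first_point_at_def lattice_shift_def)
  have "int k *s e + int j *s (- e) = int (k - j) *s e" if "j \<le> k" for j
    using that by (simp add: vec_eq_iff of_nat_diff algebra_simps)
  then have reversed: "lattice_shift (int k *s e) \<omega> (int j *s (- e)) = \<omega> (int (k - j) *s e)"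
    if "j \<le> k" for j
    using that by (simp only: lattice_shift_def)
  show "first_point_at (- e) k (lattice_shift (int k *s e) \<omega>)"
    unfolding first_point_at_def
  proof (intro conjI allI impI)
    show "0 < k" using assms(2) by (simp add: first_point_at_def)
    show "lattice_shift (int k *s e) \<omega> (int k *s (- e))"
      unfolding reversed[OF order_refl] using assms(1) by simp
    fix j assume j: "0 < j \<and> j < k"
    then have "0 < k - j \<and> k - j < k" by simp
    then have "\<not> \<omega> (int (k - j) *s e)" using assms(2) unfolding first_point_at_def by blast
    then show "\<not> lattice_shift (int k *s e) \<omega> (int j *s (- e))"
      using reversed[of j] j by simp
  qed
qed

text \<open>Looking back from the first point, the origin is the first point met. The equality of
  the two gaps is what later makes the drifts along e and -e cancel.\<close>

lemma first_return_inverse: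
  assumes "\<omega> 0" "has_point e \<omega>"
  shows "first_return e \<omega> 0" "has_point (- e) (first_return e \<omega>)"
    "first_point (- e) (first_return e \<omega>) = first_point e \<omega>"
    "first_return (- e) (first_return e \<omega>) = \<omega>"
proof -
  have "first_point_at e (first_point e \<omega>) \<omega>" using assms(2) by (simp add: first_point_at_iff)
  note r = first_point_at_reverse[OF assms(1) this]
  show "first_return e \<omega> 0" "has_point (- e) (first_return e \<omega>)"
    and *: "first_point (- e) (first_return e \<omega>) = first_point e \<omega>"
    using r by (auto simp: first_return_def first_point_at_iff)
  show "first_return (- e) (first_return e \<omega>) = \<omega>"
    unfolding first_return_def[of "- e"] *
    by (simp add: first_return_def lattice_shift_shift)
qed

lemma measurable_site [measurable]: "(\<lambda>\<omega>. \<omega> x) \<in> config_space \<rightarrow>\<^sub>M count_space UNIV"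
  unfolding config_space_def by (rule measurable_component_singleton) simp

lemma measurable_has_point [measurable]: "Measurable.pred config_space (has_point e)"
  unfolding has_point_def[abs_def] by measurable

lemma measurable_first_point_at [measurable]: "Measurable.pred config_space (first_point_at e k)"
  unfolding first_point_at_def[abs_def] by measurable

lemmas [measurable] = measurable_first_point

lemma measurable_first_return [measurable]: "first_return e \<in> config_space \<rightarrow>\<^sub>M config_space"
  unfolding first_return_def[abs_def]
  by (rule measurable_compose_countable[where g = "first_point e"]) measurable

lemma origin_occupied_sets [measurable]: "origin_occupied \<in> sets config_space"
proof -
  have "{\<omega> \<in> space config_space. \<omega> 0} \<in> sets config_space" by measurable
  then show ?thesis by (simp add: origin_occupied_def)
qed

section \<open>Stationary environments: shift invariance, recurrence and Kac's lemma\<close>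

locale stationary_config = prob_space Q for Q :: "'d::finite config measure" +
  assumes sets_Q: "sets Q = sets config_space"
    and stationary_axis: "\<And>i. invariant_measure Q (lattice_shift (axis i 1))"
    and nonempty: "measure Q {\<omega> \<in> space Q. points \<omega> = {}} < 1"
begin

lemmas [measurable_cong] = sets_Q

lemma space_Q [simp]: "space Q = UNIV"
  using sets_eq_imp_space_eq[OF sets_Q] by simp

lemma distr_shift_add:
  assumes "distr Q Q (lattice_shift x) = Q" "distr Q Q (lattice_shift y) = Q"
  shows "distr Q Q (lattice_shift (x + y)) = Q"
proof -
  have "lattice_shift (x + y) = lattice_shift y \<circ> (lattice_shift x :: 'd config \<Rightarrow> _)"
    by (auto simp: lattice_shift_shift)
  then have "distr Q Q (lattice_shift (x + y)) = distr (distr Q Q (lattice_shift x)) Q (lattice_shift y)"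
    by (simp add: distr_distr)
  then show ?thesis using assms by simp
qed

lemma distr_shift_minus:
  assumes "distr Q Q (lattice_shift x) = Q"
  shows "distr Q Q (lattice_shift (- x)) = Q"
proof -
  have "distr Q Q (lattice_shift (- x)) = distr (distr Q Q (lattice_shift x)) Q (lattice_shift (- x))"
    by (simp add: assms)
  also have "\<dots> = distr Q Q (\<lambda>\<omega>. \<omega>)"
    by (simp add: distr_distr comp_def lattice_shift_shift)
  finally show ?thesis by (simp add: distr_id2)
qed

text \<open>The vectors whose shift preserves \<open>Q\<close> are closed under sums and negation
  and contain the axis vectors, which generate the lattice.\<close>

lemma distr_shift: "distr Q Q (lattice_shift x) = Q"
proof -
  let ?I = "\<lambda>x. distr Q Q (lattice_shift x) = Q"
  have 0: "?I 0" by (simp add: distr_id2 cong: distr_cong)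
  have axis: "?I (axis i 1)" for i
    using stationary_axis by (simp add: invariant_measure_def)
  have nat: "?I (int n *s axis i 1)" for n i
  proof (induction n)
    case (Suc n)
    have "int (Suc n) *s axis i 1 = axis i 1 + int n *s (axis i 1 :: int ^ 'd)"
      by (simp add: vec_eq_iff algebra_simps)
    then show ?case using distr_shift_add[OF axis Suc] by simp
  qed (use 0 in simp)
  have int: "?I (k *s axis i 1)" for k i
  proof (cases k)
    case (neg n)
    have "k *s axis i 1 = - (int (Suc n) *s (axis i 1 :: int ^ 'd))"
      by (simp add: vec_eq_iff neg)
    then show ?thesis using distr_shift_minus[OF nat[of "Suc n" i]] by (simp only:)
  qed (use nat in simp)
  have "?I (\<Sum>i\<in>S. (x $ i) *s axis i 1)" if "finite S" for S
    using that by (induction S) (auto intro: distr_shift_add int simp: 0)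
  then have "?I (\<Sum>i\<in>UNIV. (x $ i) *s axis i 1)" by simp
  then show ?thesis by (simp only: basis_expansion)
qed

lemma nn_integral_shift:
  assumes [measurable]: "g \<in> borel_measurable config_space"
  shows "(\<integral>\<^sup>+\<omega>. g (lattice_shift x \<omega>) \<partial>Q) = (\<integral>\<^sup>+\<omega>. g \<omega> \<partial>Q)"
proof -
  have "(\<integral>\<^sup>+\<omega>. g (lattice_shift x \<omega>) \<partial>Q) = (\<integral>\<^sup>+\<omega>. g \<omega> \<partial>distr Q Q (lattice_shift x))"
    by (subst nn_integral_distr) auto
  then show ?thesis by (simp add: distr_shift)
qed

lemma emeasure_shift:
  assumes [measurable]: "Measurable.pred config_space R"
  shows "emeasure Q {\<omega>. R (lattice_shift x \<omega>)} = emeasure Q {\<omega>. R \<omega>}"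
proof -
  have "{\<omega> \<in> space Q. R \<omega>} \<in> sets Q" by measurable
  then have *: "{\<omega>. R \<omega>} \<in> sets Q" by simp
  have "emeasure Q {\<omega>. R \<omega>} = emeasure (distr Q Q (lattice_shift x)) {\<omega>. R \<omega>}"
    by (simp add: distr_shift)
  also have "\<dots> = emeasure Q {\<omega>. R (lattice_shift x \<omega>)}"
    using * by (subst emeasure_distr) (auto simp: vimage_def)
  finally show ?thesis by simp
qed

text \<open>Otherwise, by stationarity, each of the countably many sites would be empty almost
  surely, and so would the whole configuration, against \<open>nonempty\<close>.\<close>

lemma emeasure_origin_occupied: "emeasure Q origin_occupied \<noteq> 0"
proof
  assume 0: "emeasure Q origin_occupied = 0"
  have "AE \<omega> in Q. \<not> \<omega> x" for x
  proof (rule AE_I')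
    have "emeasure Q {\<omega>. lattice_shift x \<omega> 0} = emeasure Q {\<omega>. \<omega> 0}"
      by (rule emeasure_shift) measurable
    then have "emeasure Q {\<omega>. \<omega> x} = 0"
      using 0 by (simp add: lattice_shift_def origin_occupied_def)
    moreover have "{\<omega> \<in> space Q. \<omega> x} \<in> sets Q" by measurable
    ultimately show "{\<omega>. \<omega> x} \<in> null_sets Q" by (simp add: null_sets_def)
  qed auto
  then have "AE \<omega> in Q. \<forall>x. \<not> \<omega> x" by (simp add: AE_all_countable)
  then have "AE \<omega> in Q. points \<omega> = {}" by (simp add: points_def)
  moreover have "{\<omega> \<in> space Q. \<forall>x. \<not> \<omega> x} \<in> sets Q" by measurable
  then have "{\<omega> \<in> space Q. points \<omega> = {}} \<in> sets Q" by (simp add: points_def)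
  ultimately have "measure Q {\<omega> \<in> space Q. points \<omega> = {}} = 1"
    by (simp add: prob_eq_1)
  with nonempty show False by simp
qed

text \<open>Once the gap k is fixed, the first return is a deterministic shift, which preserves
  \<open>Q\<close>; by reversal it carries the event of gap k along e onto the event of gap k along
  -e.\<close>

lemma nn_integral_first_point_at:
  assumes [measurable]: "g \<in> borel_measurable config_space"
  shows "(\<integral>\<^sup>+\<omega>. g (lattice_shift (int k *s e) \<omega>) * indicator {\<omega>. \<omega> 0 \<and> first_point_at e k \<omega>} \<omega> \<partial>Q) =
     (\<integral>\<^sup>+\<omega>. g \<omega> * indicator {\<omega>. \<omega> 0 \<and> first_point_at (- e) k \<omega>} \<omega> \<partial>Q)"
proof -
  have [measurable]: "{\<omega>. \<omega> 0 \<and> first_point_at e k \<omega>} \<in> sets config_space" for e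
  proof -
    have "{\<omega> \<in> space config_space. \<omega> 0 \<and> first_point_at e k \<omega>} \<in> sets config_space" by measurable
    then show ?thesis by simp
  qed
  have "\<omega> 0 \<and> first_point_at e k \<omega> \<longleftrightarrow> lattice_shift (int k *s e) \<omega> 0 \<and>
      first_point_at (- e) k (lattice_shift (int k *s e) \<omega>)" (is "_ \<longleftrightarrow> ?\<omega>' 0 \<and> _") for \<omega>
  proof
    assume "?\<omega>' 0 \<and> first_point_at (- e) k ?\<omega>'"
    then have "lattice_shift (int k *s (- e)) ?\<omega>' 0"
      "first_point_at e k (lattice_shift (int k *s (- e)) ?\<omega>')"
      using first_point_at_reverse[of ?\<omega>' "- e" k] by auto
    moreover have "int k *s e + int k *s (- e) = 0" by (simp add: vec_eq_iff)
    ultimately show "\<omega> 0 \<and> first_point_at e k \<omega>" by (simp add: lattice_shift_shift)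
  qed (use first_point_at_reverse in blast)
  then have "(\<integral>\<^sup>+\<omega>. g (lattice_shift (int k *s e) \<omega>) *
        indicator {\<omega>. \<omega> 0 \<and> first_point_at e k \<omega>} \<omega> \<partial>Q) =
     (\<integral>\<^sup>+\<omega>. g (lattice_shift (int k *s e) \<omega>) *
        indicator {\<omega>. \<omega> 0 \<and> first_point_at (- e) k \<omega>} (lattice_shift (int k *s e) \<omega>) \<partial>Q)"
    by (simp add: indicator_def)
  also have "\<dots> = (\<integral>\<^sup>+\<omega>. g \<omega> * indicator {\<omega>. \<omega> 0 \<and> first_point_at (- e) k \<omega>} \<omega> \<partial>Q)"
    by (rule nn_integral_shift) measurable
  finally show ?thesis .
qed

text \<open>At most the term k = \<open>first_point e \<omega>\<close> of the series is nonzero. The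
  dependence of g on k allows integrands that involve the random shift.\<close>

lemma nn_integral_has_point:
  assumes [measurable]: "\<And>k. g k \<in> borel_measurable config_space"
  shows "(\<integral>\<^sup>+\<omega>. g (first_point e \<omega>) \<omega> * indicator {\<omega>. \<omega> 0 \<and> has_point e \<omega>} \<omega> \<partial>Q) =
     (\<Sum>k. \<integral>\<^sup>+\<omega>. g k \<omega> * indicator {\<omega>. \<omega> 0 \<and> first_point_at e k \<omega>} \<omega> \<partial>Q)"
proof -
  have [measurable]: "{\<omega>. \<omega> 0 \<and> first_point_at e k \<omega>} \<in> sets config_space" for k
  proof -
    have "{\<omega> \<in> space config_space. \<omega> 0 \<and> first_point_at e k \<omega>} \<in> sets config_space" by measurable
    then show ?thesis by simp
  qed
  have "g (first_point e \<omega>) \<omega> * indicator {\<omega>. \<omega> 0 \<and> has_point e \<omega>} \<omega> =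
     (\<Sum>k. g k \<omega> * indicator {\<omega>. \<omega> 0 \<and> first_point_at e k \<omega>} \<omega>)" for \<omega>
    by (subst suminf_finite[of "{first_point e \<omega>}"]) (auto simp: first_point_at_iff indicator_def)
  then show ?thesis by (simp add: nn_integral_suminf)
qed

text \<open>Poincare recurrence: let \<open>B n\<close> be the event that the n-th site of the ray
  is its last point. These events are disjoint and, by stationarity, equally likely; a summable
  constant is 0.\<close>

lemma AE_has_point: "AE \<omega> in Q. \<omega> 0 \<longrightarrow> has_point e \<omega>"
proof -
  define B where "B n = {\<omega>. \<omega> (int n *s e) \<and> (\<forall>k>0. \<not> \<omega> (int (n + k) *s e))}" for n
  have meas: "B n \<in> sets Q" for n
  proof -
    have "{\<omega> \<in> space Q. \<omega> (int n *s e) \<and> (\<forall>k>0. \<not> \<omega> (int (n + k) *s e))} \<in> sets Q" by measurable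
    then show ?thesis by (simp add: B_def)
  qed
  have eq: "measure Q (B n) = measure Q (B 0)" for n
  proof -
    have sum: "int n *s e + int k *s e = int (n + k) *s e" for k n
      by (simp add: vec_eq_iff algebra_simps)
    have "B n = {\<omega>. lattice_shift (int n *s e) \<omega> \<in> B 0}"
      unfolding B_def lattice_shift_def mem_Collect_eq sum by (simp only: add_0_right add_0_left)
    moreover have "emeasure Q {\<omega>. lattice_shift (int n *s e) \<omega> \<in> B 0} = emeasure Q {\<omega>. \<omega> \<in> B 0}"
      using meas[of 0] by (intro emeasure_shift) (simp add: sets_Q)
    ultimately show ?thesis by (simp only: measure_def Collect_mem_eq)
  qed
  have "disjoint_family B"
  proof -
    have "B n \<inter> B m = {}" if "n < m" for n m
    proof -
      have "\<omega> \<notin> B m" if "\<omega> \<in> B n" for \<omega>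
      proof -
        have "\<forall>k>0. \<not> \<omega> (int (n + k) *s e)" using that unfolding B_def by blast
        then have "\<not> \<omega> (int (n + (m - n)) *s e)" using \<open>n < m\<close> by (meson zero_less_diff)
        then have "\<not> \<omega> (int m *s e)" using \<open>n < m\<close> by simp
        then show ?thesis unfolding B_def by blast
      qed
      then show ?thesis by blast
    qed
    then show ?thesis
      unfolding disjoint_family_on_def by (metis Int_commute linorder_neqE_nat)
  qed
  then have "(\<lambda>n. measure Q (B n)) sums measure Q (\<Union>n. B n)"
    using meas by (intro finite_measure_UNION) auto
  then have "summable (\<lambda>n. measure Q (B n))" by (rule sums_summable)
  moreover have "(\<lambda>n. measure Q (B n)) = (\<lambda>n. measure Q (B 0))" by (rule ext) (rule eq)
  ultimately have "summable (\<lambda>n::nat. measure Q (B 0))" by (simp only:)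
  then have "measure Q (B 0) = 0" by (simp only: summable_const_iff)
  then have "AE \<omega> in Q. \<omega> \<notin> B 0"
    using meas[of 0] by (intro AE_not_in) (simp add: null_sets_def emeasure_eq_measure)
  then show ?thesis
    by eventually_elim (auto simp: B_def has_point_def)
qed

text \<open>Kac's lemma, by stationarity: the events that the last point at or before the origin in
  direction \<open>e\<close> is at distance exactly \<open>k\<close> are disjoint.\<close>

lemma kac: "(\<integral>\<^sup>+\<omega>. of_nat (first_point e \<omega>) * indicator origin_occupied \<omega> \<partial>Q) \<le> 1"
proof -
  \<comment> \<open>With the origin occupied, \<open>C k\<close> says that the gap exceeds k, so the
    indicators of \<open>C k\<close> add up to the gap. The event \<open>D k\<close> is
    \<open>C k\<close> viewed after a shift by k steps.\<close>
  define C where "C k = {\<omega>. \<omega> 0 \<and> (\<forall>j. 0 < j \<and> j \<le> k \<longrightarrow> \<not> \<omega> (int j *s e))}" for k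
  define D where "D k = {\<omega>. \<omega> (- (int k *s e)) \<and> (\<forall>j<k. \<not> \<omega> (- (int j *s e)))}" for k
  have C [measurable]: "C k \<in> sets config_space" for k
  proof -
    have "{\<omega> \<in> space config_space. \<omega> 0 \<and> (\<forall>j. 0 < j \<and> j \<le> k \<longrightarrow> \<not> \<omega> (int j *s e))}
      \<in> sets config_space" by measurable
    then show ?thesis by (simp add: C_def)
  qed
  have D: "D k \<in> sets Q" for k
  proof -
    have "{\<omega> \<in> space Q. \<omega> (- (int k *s e)) \<and> (\<forall>j<k. \<not> \<omega> (- (int j *s e)))} \<in> sets Q"
      by measurable
    then show ?thesis by (simp add: D_def)
  qed
  have CD: "emeasure Q (C k) = emeasure Q (D k)" for k
  proof -
    let ?s = "lattice_shift (- (int k *s e))"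
    have "?s \<omega> \<in> C k \<longleftrightarrow> \<omega> \<in> D k" for \<omega>
    proof -
      have *: "int j *s e - int k *s e = - (int (k - j) *s e)" if "j \<le> k" for j
        using that by (simp add: vec_eq_iff of_nat_diff algebra_simps)
      have "?s \<omega> \<in> C k \<longleftrightarrow> \<omega> (- (int k *s e)) \<and>
          (\<forall>j. 0 < j \<and> j \<le> k \<longrightarrow> \<not> \<omega> (int j *s e - int k *s e))"
        by (simp add: C_def lattice_shift_def)
      also have "\<dots> \<longleftrightarrow> \<omega> (- (int k *s e)) \<and> (\<forall>j. 0 < j \<and> j \<le> k \<longrightarrow> \<not> \<omega> (- (int (k - j) *s e)))"
        by (metis *)
      also have "\<dots> \<longleftrightarrow> \<omega> \<in> D k"
        unfolding D_def mem_Collect_eq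
      proof (intro conj_cong refl iffI allI impI)
        fix j assume "\<forall>j. 0 < j \<and> j \<le> k \<longrightarrow> \<not> \<omega> (- (int (k - j) *s e))" "j < k"
        then show "\<not> \<omega> (- (int j *s e))" by (auto dest: spec[of _ "k - j"])
      next
        fix j assume "\<forall>j<k. \<not> \<omega> (- (int j *s e))" "0 < j \<and> j \<le> k"
        then show "\<not> \<omega> (- (int (k - j) *s e))" by (metis diff_less less_le_trans)
      qed
      finally show ?thesis .
    qed
    moreover have "emeasure Q {\<omega>. ?s \<omega> \<in> C k} = emeasure Q {\<omega>. \<omega> \<in> C k}"
      by (rule emeasure_shift) measurable
    ultimately show ?thesis by simp
  qed
  have "disjoint_family D"
  proof -
    have "D n \<inter> D m = {}" if "n < m" for n m using that by (auto simp: D_def)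
    then show ?thesis
      unfolding disjoint_family_on_def by (metis Int_commute linorder_neqE_nat)
  qed
  then have "(\<Sum>k. emeasure Q (D k)) = emeasure Q (\<Union>k. D k)"
    using D by (intro suminf_emeasure) auto
  then have le: "(\<Sum>k. emeasure Q (C k)) \<le> 1" by (simp add: CD measure_le_1)
  have "(\<integral>\<^sup>+\<omega>. of_nat (first_point e \<omega>) * indicator origin_occupied \<omega> \<partial>Q) =
    (\<integral>\<^sup>+\<omega>. (\<Sum>k. indicator (C k) \<omega>) \<partial>Q)"
  \<comment> \<open>Recurrence is needed here: with the origin occupied and no point along e the
    series would diverge, while \<open>first_point\<close> is some natural number.\<close>
  proof (rule nn_integral_cong_AE, use AE_has_point[of e] in eventually_elim)
    fix \<omega> assume *: "\<omega> 0 \<longrightarrow> has_point e \<omega>"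
    show "of_nat (first_point e \<omega>) * indicator origin_occupied \<omega> = (\<Sum>k. indicator (C k) \<omega> :: ennreal)"
    proof (cases "\<omega> 0")
      case True
      with * have f: "first_point_at e (first_point e \<omega>) \<omega>" by (simp add: first_point_at_iff)
      have "\<omega> \<in> C k \<longleftrightarrow> k < first_point e \<omega>" for k
      proof
        assume "\<omega> \<in> C k"
        then have "\<not> (0 < first_point e \<omega> \<and> first_point e \<omega> \<le> k)"
          using f by (auto simp: C_def first_point_at_def)
        then show "k < first_point e \<omega>" using f by (simp add: first_point_at_def)
      qed (use f True in \<open>auto simp: C_def first_point_at_def\<close>)
      then have "(\<Sum>k. indicator (C k) \<omega> :: ennreal) = (\<Sum>k<first_point e \<omega>. indicator (C k) \<omega>)"
        by (intro suminf_finite) (auto simp: indicator_def)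
      also have "\<dots> = (\<Sum>k<first_point e \<omega>. 1)"
        using \<open>\<And>k. \<omega> \<in> C k \<longleftrightarrow> k < first_point e \<omega>\<close> by (intro sum.cong) auto
      finally show ?thesis using True by (simp add: origin_occupied_def)
    qed (simp add: origin_occupied_def C_def)
  qed
  also have "\<dots> = (\<Sum>k. emeasure Q (C k))" by (simp add: nn_integral_suminf)
  finally show ?thesis using le by simp
qed

section \<open>The environment conditioned on an occupied origin\<close>

abbreviation P :: "'d config measure" where "P \<equiv> conditioned Q"

lemma prob_space_P: "prob_space P"
  unfolding conditioned_def
  using emeasure_origin_occupied by (intro prob_space_uniform_measure) auto

lemma sets_P [measurable_cong]: "sets P = sets config_space"
  by (simp add: sets_Q)

lemma space_P [simp]: "space P = UNIV"
  using sets_eq_imp_space_eq[OF sets_P] by simp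

lemma nn_integral_P:
  assumes [measurable]: "g \<in> borel_measurable config_space"
  shows "(\<integral>\<^sup>+\<omega>. g \<omega> \<partial>P) = (\<integral>\<^sup>+\<omega>. g \<omega> * indicator origin_occupied \<omega> \<partial>Q) / emeasure Q origin_occupied"
  unfolding conditioned_def by (rule nn_integral_uniform_measure) measurable

lemma AE_P: "AE \<omega> in P. \<omega> 0 \<and> (\<forall>e\<in>directions. has_point e \<omega>)"
proof -
  have "AE \<omega> in P. \<omega> 0 \<and> has_point e \<omega>" for e
    unfolding conditioned_def
  proof (rule AE_uniform_measureI)
    show "AE \<omega> in Q. \<omega> \<in> origin_occupied \<longrightarrow> \<omega> 0 \<and> has_point e \<omega>"
      using AE_has_point[of e] by (auto simp: origin_occupied_def)
  qed measurable
  then have "AE \<omega> in P. \<forall>e\<in>directions. \<omega> 0 \<and> has_point e \<omega>"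
    by (intro AE_finite_allI finite_directions)
  then show ?thesis using directions_nonempty by auto
qed

text \<open>Split by the value of the gap along e, shift each piece deterministically, and
  reassemble by the gap along -e. Recurrence in both directions makes the two resulting events equal
  to \<open>origin_occupied\<close> up to null sets.\<close>

lemma nn_integral_first_return:
  assumes [measurable]: "g \<in> borel_measurable config_space"
  shows "(\<integral>\<^sup>+\<omega>. g (first_return e \<omega>) \<partial>P) = (\<integral>\<^sup>+\<omega>. g \<omega> \<partial>P)"
proof -
  have pos: "(\<integral>\<^sup>+\<omega>. h \<omega> * indicator origin_occupied \<omega> \<partial>Q) =
      (\<integral>\<^sup>+\<omega>. h \<omega> * indicator {\<omega>. \<omega> 0 \<and> has_point e \<omega>} \<omega> \<partial>Q)"
    for h :: "'d config \<Rightarrow> ennreal" and e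
    by (rule nn_integral_cong_AE, use AE_has_point[of e] in eventually_elim)
       (auto simp: origin_occupied_def indicator_def)
  have "(\<integral>\<^sup>+\<omega>. g (first_return e \<omega>) * indicator {\<omega>. \<omega> 0 \<and> has_point e \<omega>} \<omega> \<partial>Q) =
    (\<Sum>k. \<integral>\<^sup>+\<omega>. g (lattice_shift (int k *s e) \<omega>) * indicator {\<omega>. \<omega> 0 \<and> first_point_at e k \<omega>} \<omega> \<partial>Q)"
    unfolding first_return_def
    by (rule nn_integral_has_point[where g = "\<lambda>k \<omega>. g (lattice_shift (int k *s e) \<omega>)"]) measurable
  also have "\<dots> = (\<Sum>k. \<integral>\<^sup>+\<omega>. g \<omega> * indicator {\<omega>. \<omega> 0 \<and> first_point_at (- e) k \<omega>} \<omega> \<partial>Q)"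
    by (simp add: nn_integral_first_point_at)
  also have "\<dots> = (\<integral>\<^sup>+\<omega>. g \<omega> * indicator {\<omega>. \<omega> 0 \<and> has_point (- e) \<omega>} \<omega> \<partial>Q)"
    by (rule nn_integral_has_point[symmetric]) measurable
  finally have "(\<integral>\<^sup>+\<omega>. g (first_return e \<omega>) * indicator origin_occupied \<omega> \<partial>Q) =
      (\<integral>\<^sup>+\<omega>. g \<omega> * indicator origin_occupied \<omega> \<partial>Q)"
    unfolding pos[of "\<lambda>\<omega>. g (first_return e \<omega>)" e] pos[of g "- e"] .
  then show ?thesis by (simp add: nn_integral_P)
qed

lemma distr_first_return: "distr P P (first_return e) = P"
proof (rule measure_eqI)
  fix A assume "A \<in> sets (distr P P (first_return e))"
  then have [measurable]: "A \<in> sets config_space" by (simp add: sets_Q)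
  have "emeasure (distr P P (first_return e)) A = (\<integral>\<^sup>+\<omega>. indicator A \<omega> \<partial>distr P P (first_return e))"
    by simp
  also have "\<dots> = (\<integral>\<^sup>+\<omega>. indicator A (first_return e \<omega>) \<partial>P)"
    by (rule nn_integral_distr) measurable
  also have "\<dots> = emeasure P A" by (simp add: nn_integral_first_return)
  finally show "emeasure (distr P P (first_return e)) A = emeasure P A" .
qed simp

lemma first_point_finite_integral: "(\<integral>\<^sup>+\<omega>. of_nat (first_point e \<omega>) \<partial>P) < \<infinity>"
proof -
  have "(\<integral>\<^sup>+\<omega>. of_nat (first_point e \<omega>) \<partial>P) \<le> 1 / emeasure Q origin_occupied"
    by (subst nn_integral_P) (auto intro!: divide_right_mono_ennreal kac)
  also have "\<dots> < \<infinity>" using emeasure_origin_occupied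
    by (simp add: ennreal_divide_eq_top_iff less_top[symmetric])
  finally show ?thesis .
qed

end

section \<open>The Markov property of the quenched walk\<close>

lemma measurable_path [measurable]:
  "(\<lambda>X. X n) \<in> path_space \<rightarrow>\<^sub>M count_space (UNIV :: (int ^ 'd::finite) set)"
  unfolding path_space_def by (rule measurable_component_singleton) simp

text \<open>Since the lattice is countable, path prefixes coded as lists form a countable type.
  Their law is determined by point masses, that is, by cylinders fixing every coordinate up to n,
  and it determines all finite-dimensional events.\<close>

lemma path_measure_eqI:
  fixes M N :: "(nat \<Rightarrow> int ^ 'd::finite) measure"
  assumes M: "sets M = sets path_space" and N: "sets N = sets path_space" and fin: "finite_measure M"
    and eq: "\<And>n x. emeasure M {X. \<forall>i\<le>n. X i = x i} = emeasure N {X. \<forall>i\<le>n. X i = x i}"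
  shows "M = N"
proof (rule measure_eqI_PiM_infinite[where I = UNIV and M = "\<lambda>_. count_space UNIV"])
  show "sets M = sets (PiM UNIV (\<lambda>_. count_space UNIV))"
    "sets N = sets (PiM UNIV (\<lambda>_. count_space UNIV))"
    using M N by (simp_all add: path_space_def)
  have sp: "space M = UNIV" "space N = UNIV"
    using sets_eq_imp_space_eq[OF M] sets_eq_imp_space_eq[OF N] by simp_all
  fix A :: "nat \<Rightarrow> (int ^ 'd) set" and J :: "nat set" assume J: "finite J"
  \<comment> \<open>Inserting 0 keeps the maximum meaningful for empty \<open>J\<close>.\<close>
  define n where "n = Max (insert 0 J)"
  define r where "r X = map X [0..<Suc n]" for X :: "nat \<Rightarrow> int ^ 'd"
  have nth: "r X ! i = X i" if "i \<le> n" for X i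
    using that by (simp add: r_def del: upt_Suc)
  have r_eq: "{X. r X = l} = (if length l = Suc n then {X. \<forall>i\<le>n. X i = l ! i} else {})" for l
    by (auto simp: r_def list_eq_iff_nth_eq less_Suc_eq_le simp del: upt_Suc)
  have cyl: "{X. \<forall>i\<le>n. X i = x i} \<in> sets path_space" for x :: "nat \<Rightarrow> int ^ 'd"
  proof -
    have "{X \<in> space path_space. \<forall>i\<le>n. X i = x i} \<in> sets path_space" by measurable
    then show ?thesis by simp
  qed
  have r: "r \<in> path_space \<rightarrow>\<^sub>M count_space UNIV"
    using cyl by (subst measurable_count_space_eq_countable) (auto simp: vimage_def r_eq)
  then have rM: "r \<in> M \<rightarrow>\<^sub>M count_space UNIV" and rN: "r \<in> N \<rightarrow>\<^sub>M count_space UNIV"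
    by (simp_all add: measurable_cong_sets[OF M refl] measurable_cong_sets[OF N refl])
  have "distr M (count_space UNIV) r = distr N (count_space UNIV) r"
  proof (rule measure_eqI_countable[where A = UNIV])
    fix l
    show "emeasure (distr M (count_space UNIV) r) {l} = emeasure (distr N (count_space UNIV) r) {l}"
      using eq by (simp add: emeasure_distr rM rN vimage_def sp r_eq)
  qed simp_all
  moreover define L where "L = {l. \<forall>j\<in>J. l ! j \<in> A j}"
  ultimately have "emeasure M (r -` L \<inter> space M) = emeasure N (r -` L \<inter> space N)"
    using rM rN by (metis emeasure_distr UNIV_I sets_count_space Pow_UNIV)
  moreover have "prod_emb UNIV (\<lambda>_. count_space UNIV) J (Pi\<^sub>E J A) = r -` L"
  proof -
    have "j \<le> n" if "j \<in> J" for j using that J by (simp add: n_def)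
    then show ?thesis by (auto simp: prod_emb_def L_def nth PiE_iff)
  qed
  ultimately show "emeasure M (prod_emb UNIV (\<lambda>_. count_space UNIV) J (Pi\<^sub>E J A)) =
      emeasure N (prod_emb UNIV (\<lambda>_. count_space UNIV) J (Pi\<^sub>E J A))"
    by (simp add: sp)
qed (rule fin)

text \<open>Time shift followed by recentring, so that the new path starts at 0 as under
  \<open>quenched_law\<close>.\<close>

definition path_step :: "(nat \<Rightarrow> int ^ 'd) \<Rightarrow> nat \<Rightarrow> int ^ 'd" where
  "path_step X n = X (Suc n) - X 1"

lemma measurable_path_step [measurable]:
  "path_step \<in> (path_space :: (nat \<Rightarrow> int ^ 'd::finite) measure) \<rightarrow>\<^sub>M path_space"
proof -
  have "(\<lambda>X. path_step X n) \<in> path_space \<rightarrow>\<^sub>M count_space (UNIV :: (int ^ 'd) set)" for n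
    unfolding path_step_def
    by (rule measurable_compose_countable[where g = "\<lambda>X. X 1"])
       (auto intro: measurable_compose[OF measurable_path])
  then show ?thesis
    by (subst (2) path_space_def) (rule measurable_PiM_single', auto)
qed

lemma neighbours_shift:
  "neighbours (lattice_shift y \<omega>) v = (\<lambda>u. u - y) ` neighbours \<omega> (y + v)"
  by (auto simp: neighbours_eq_image image_image lattice_shift_shift)

text \<open>Translation covariance: recentring the walk amounts to shifting the environment.\<close>

lemma pmf_walk_step_shift:
  "pmf (walk_step (lattice_shift y \<omega>) v) u = pmf (walk_step \<omega> (y + v)) (y + u)"
proof -
  have inj: "inj_on (\<lambda>u. u - y) S" for S by (rule inj_onI) simp
  have "u \<in> (\<lambda>u. u - y) ` neighbours \<omega> (y + v) \<longleftrightarrow> y + u \<in> neighbours \<omega> (y + v)"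
    by (auto simp: image_iff algebra_simps intro!: bexI[of _ "y + u"])
  then show ?thesis
    by (simp add: walk_step_def pmf_of_set finite_neighbours neighbours_nonempty
        neighbours_shift card_image[OF inj] indicator_def)
qed

lemma emeasure_quenched_law_cylinder:
  "emeasure (quenched_law \<omega>) {X. \<forall>i\<le>n. X i = x i} =
     ennreal (if x 0 = 0 then \<Prod>i<n. pmf (walk_step \<omega> (x i)) (x (Suc i)) else 0)"
proof -
  interpret prob_space "quenched_law \<omega>" by (rule prob_space_quenched_law)
  show ?thesis by (simp add: emeasure_eq_measure quenched_law_cylinder)
qed

lemma AE_quenched_law_start: "AE X in quenched_law \<omega>. X 0 = 0"
proof -
  interpret prob_space "quenched_law \<omega>" by (rule prob_space_quenched_law)
  have "{X \<in> space path_space. X 0 = 0} \<in> sets (path_space :: (nat \<Rightarrow> int ^ 'a) measure)"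
    by measurable
  moreover have "measure (quenched_law \<omega>) {X. X 0 = 0} = 1"
    using quenched_law_cylinder[of \<omega> 0 "\<lambda>_. 0"] by simp
  ultimately have "AE X in quenched_law \<omega>. X \<in> {X. X 0 = 0}" by (subst (asm) prob_eq_1) auto
  then show ?thesis by simp
qed

text \<open>The Markov property at time 1 on the event that the first step goes to y. Both sides are
  integrals of h against measures on path space, and these agree on cylinders because the product
  formula splits off its first transition.\<close>

lemma nn_integral_first_step_at:
  fixes y :: "int ^ 'd::finite"
  assumes [measurable]: "h \<in> borel_measurable path_space"
  shows "(\<integral>\<^sup>+X. h (path_step X) * indicator {y} (X 1) \<partial>quenched_law \<omega>) =
    ennreal (pmf (walk_step \<omega> 0) y) * (\<integral>\<^sup>+X. h X \<partial>quenched_law (lattice_shift y \<omega>))"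
proof -
  let ?q = "quenched_law \<omega>"
  interpret prob_space ?q by (rule prob_space_quenched_law)
  define M where "M = distr (density ?q (\<lambda>X. indicator {y} (X 1))) path_space path_step"
  define N where "N = scale_measure (ennreal (pmf (walk_step \<omega> 0) y)) (quenched_law (lattice_shift y \<omega>))"
  have nn_M: "(\<integral>\<^sup>+X. g X \<partial>M) = (\<integral>\<^sup>+X. g (path_step X) * indicator {y} (X 1) \<partial>?q)"
    if [measurable]: "g \<in> borel_measurable path_space" for g
    unfolding M_def by (subst nn_integral_distr) (auto simp: nn_integral_density mult.commute)
  have "M = N"
  proof (rule path_measure_eqI)
    show "finite_measure M"
    proof
      have "emeasure M (space M) = (\<integral>\<^sup>+X. 1 \<partial>M)" by simp
      also have "\<dots> = (\<integral>\<^sup>+X. 1 * indicator {y} (X 1) \<partial>?q)" by (rule nn_M) simp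
      also have "\<dots> \<le> (\<integral>\<^sup>+X. 1 \<partial>?q)"
        by (intro nn_integral_mono) (simp add: indicator_def)
      also have "\<dots> < \<infinity>" using emeasure_space_1 by simp
      finally show "emeasure M (space M) \<noteq> \<infinity>" by simp
    qed
    fix n and x :: "nat \<Rightarrow> int ^ 'd"
    have [measurable]: "{X. \<forall>i\<le>n. X i = x i} \<in> sets path_space" for n and x :: "nat \<Rightarrow> int ^ 'd"
    proof -
      have "{X \<in> space path_space. \<forall>i\<le>n. X i = x i} \<in> sets path_space" by measurable
      then show ?thesis by simp
    qed
    \<comment> \<open>The original path before recentring: it starts at 0 and is at y + x i at time
      i + 1. It visits y at time 1 exactly when x 0 = 0.\<close>
    define x' where "x' = case_nat 0 (\<lambda>i. y + x i)"
    have "emeasure M {X. \<forall>i\<le>n. X i = x i} =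
      (\<integral>\<^sup>+X. indicator {X. \<forall>i\<le>n. X i = x i} (path_step X) * indicator {y} (X 1) \<partial>?q)"
      by (subst nn_M[symmetric]) (auto simp: M_def)
    also have "\<dots> = (\<integral>\<^sup>+X. (if x 0 = 0 then indicator {X. \<forall>i\<le>Suc n. X i = x' i} X else 0) \<partial>?q)"
    proof (rule nn_integral_cong_AE, use AE_quenched_law_start[of \<omega>] in eventually_elim)
      fix X :: "nat \<Rightarrow> int ^ 'd" assume X0: "X 0 = 0"
      have all: "(\<forall>i\<le>Suc n. X i = x' i) \<longleftrightarrow> (\<forall>i\<le>n. X (Suc i) = y + x i)"
        by (simp only: less_Suc_eq_le[symmetric] All_less_Suc2) (simp add: x'_def X0)
      have "(\<forall>i\<le>n. path_step X i = x i) \<and> X 1 = y \<longleftrightarrow> x 0 = 0 \<and> (\<forall>i\<le>n. X (Suc i) = y + x i)"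
      proof
        assume h: "(\<forall>i\<le>n. path_step X i = x i) \<and> X 1 = y"
        then have *: "x i = X (Suc i) - y" if "i \<le> n" for i
          using that unfolding path_step_def by metis
        have "x 0 = 0" using *[of 0] h by simp
        moreover have "X (Suc i) = y + x i" if "i \<le> n" for i using *[OF that] by simp
        ultimately show "x 0 = 0 \<and> (\<forall>i\<le>n. X (Suc i) = y + x i)" by blast
      next
        assume h: "x 0 = 0 \<and> (\<forall>i\<le>n. X (Suc i) = y + x i)"
        then have "X 1 = y" by (metis One_nat_def add.right_neutral le0)
        moreover from this h have "path_step X i = x i" if "i \<le> n" for i
          using that unfolding path_step_def by (metis add_diff_cancel_left')
        ultimately show "(\<forall>i\<le>n. path_step X i = x i) \<and> X 1 = y" by blast
      qed
      then show "indicator {X. \<forall>i\<le>n. X i = x i} (path_step X) * indicator {y} (X 1) =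
          (if x 0 = 0 then indicator {X. \<forall>i\<le>Suc n. X i = x' i} X else 0 :: ennreal)"
        by (simp only: indicator_def mem_Collect_eq all) auto
    qed
    also have "\<dots> = (if x 0 = 0 then emeasure ?q {X. \<forall>i\<le>Suc n. X i = x' i} else 0)"
      by simp
    \<comment> \<open>The first factor of the product is the weight in \<open>N\<close>; translation
      covariance turns the others into transitions in the environment shifted by y.\<close>
    also have "\<dots> = emeasure N {X. \<forall>i\<le>n. X i = x i}"
      by (simp add: N_def emeasure_quenched_law_cylinder x'_def prod.lessThan_Suc_shift
          pmf_walk_step_shift ennreal_mult[symmetric] prod_nonneg del: prod.lessThan_Suc)
    finally show "emeasure M {X. \<forall>i\<le>n. X i = x i} = emeasure N {X. \<forall>i\<le>n. X i = x i}" .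
  qed (simp_all add: M_def N_def)
  then have "(\<integral>\<^sup>+X. h X \<partial>M) = (\<integral>\<^sup>+X. h X \<partial>N)" by simp
  then show ?thesis
    by (subst (asm) nn_M) (simp_all add: N_def nn_integral_scale_measure)
qed

text \<open>Sum over the countably many values of X 1. The integrand may depend on this value so
  that the shifted environment can enter it.\<close>

lemma nn_integral_first_step:
  assumes [measurable]: "\<And>y. h y \<in> borel_measurable (path_space :: (nat \<Rightarrow> int ^ 'd::finite) measure)"
  shows "(\<integral>\<^sup>+X. h (X 1) (path_step X) \<partial>quenched_law \<omega>) =
    (\<integral>\<^sup>+y. \<integral>\<^sup>+X. h y X \<partial>quenched_law (lattice_shift y \<omega>) \<partial>walk_step \<omega> 0)"
proof -
  have "(\<integral>\<^sup>+X. h (X 1) (path_step X) \<partial>quenched_law \<omega>) =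
    (\<integral>\<^sup>+X. (\<integral>\<^sup>+y. h y (path_step X) * indicator {y} (X 1) \<partial>count_space UNIV) \<partial>quenched_law \<omega>)"
  proof (rule nn_integral_cong)
    fix X :: "nat \<Rightarrow> int ^ 'd"
    have "(\<integral>\<^sup>+y. h y (path_step X) * indicator {y} (X 1) \<partial>count_space UNIV) =
      (\<integral>\<^sup>+y. h y (path_step X) * indicator {X 1} y \<partial>count_space UNIV)"
      by (auto intro!: nn_integral_cong simp: indicator_def)
    also have "\<dots> = h (X 1) (path_step X)"
      by (subst nn_integral_indicator_singleton) auto
    finally show "h (X 1) (path_step X) =
      (\<integral>\<^sup>+y. h y (path_step X) * indicator {y} (X 1) \<partial>count_space UNIV)" ..
  qed
  also have "\<dots> = (\<integral>\<^sup>+y. \<integral>\<^sup>+X. h y (path_step X) * indicator {y} (X 1) \<partial>quenched_law \<omega> \<partial>count_space UNIV)"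
    by (rule nn_integral_count_space_nn_integral) auto
  also have "\<dots> = (\<integral>\<^sup>+y. \<integral>\<^sup>+X. h y X \<partial>quenched_law (lattice_shift y \<omega>) \<partial>walk_step \<omega> 0)"
    unfolding nn_integral_measure_pmf nn_integral_first_step_at[OF assms] ..
  finally show ?thesis .
qed

text \<open>When all gaps exist they are positive, so distinct directions lead to distinct
  neighbours, and a uniform neighbour is the image of a uniform direction.\<close>

lemma nn_integral_walk_step:
  fixes \<omega> :: "'d::finite config" and g :: "int ^ 'd \<Rightarrow> ennreal"
  assumes "\<And>e. e \<in> directions \<Longrightarrow> has_point e \<omega>"
  shows "(\<integral>\<^sup>+y. g y \<partial>walk_step \<omega> 0) =
    (\<Sum>e\<in>directions. g (int (first_point e \<omega>) *s e)) / of_nat (2 * CARD('d))"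
proof -
  have inj: "inj_on (\<lambda>e. int (first_point e \<omega>) *s e) directions"
  proof (rule inj_onI)
    fix e e' :: "int ^ 'd"
    assume *: "e \<in> directions" "e' \<in> directions"
      "int (first_point e \<omega>) *s e = int (first_point e' \<omega>) *s e'"
    have "0 < first_point e \<omega>" if "e \<in> directions" for e
      using assms[OF that] first_point_at_iff[of e "first_point e \<omega>" \<omega>]
      by (simp add: first_point_at_def)
    with * show "e = e'" by (auto intro: direction_multiple_eq)
  qed
  have "neighbours \<omega> 0 = (\<lambda>e. int (first_point e \<omega>) *s e) ` directions"
    by (simp add: neighbours_eq_image)
  then have "walk_step \<omega> 0 = map_pmf (\<lambda>e. int (first_point e \<omega>) *s e) (pmf_of_set directions)"
    unfolding walk_step_def using inj
    by (simp add: map_pmf_of_set_inj finite_directions directions_nonempty)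
  then show ?thesis
    by (simp add: nn_integral_pmf_of_set finite_directions directions_nonempty card_directions
        del: of_nat_mult)
qed

section \<open>The environment viewed from the walk\<close>

text \<open>The average of the energies \<open>(r - r \<circ> \<sigma> e)\<^sup>2\<close> vanishes.\<close>

lemma (in prob_space) harmonic_imp_invariant:
  fixes r :: "'a \<Rightarrow> real"
  assumes E: "finite E" and e: "e \<in> E"
    and \<sigma>: "\<And>e. e \<in> E \<Longrightarrow> \<sigma> e \<in> M \<rightarrow>\<^sub>M M" "\<And>e. e \<in> E \<Longrightarrow> distr M M (\<sigma> e) = M"
    and r [measurable]: "r \<in> borel_measurable M" and bound: "\<And>x. \<bar>r x\<bar> \<le> B"
    and harmonic: "AE x in M. real (card E) * r x = (\<Sum>e\<in>E. r (\<sigma> e x))"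
  shows "AE x in M. r (\<sigma> e x) = r x"
proof -
  have [measurable]: "(\<lambda>x. r (\<sigma> e x)) \<in> borel_measurable M" if "e \<in> E" for e
    using \<sigma>(1)[OF that] r by (rule measurable_compose)
  have int: "integrable M (\<lambda>x. g x * h x)"
    if [measurable]: "g \<in> borel_measurable M" "h \<in> borel_measurable M"
      and "\<And>x. \<bar>g x\<bar> \<le> B" "\<And>x. \<bar>h x\<bar> \<le> B" for g h :: "'a \<Rightarrow> real"
  proof (rule integrable_const_bound[where B = "B * B"])
    have "0 \<le> B" using bound abs_ge_zero order_trans by blast
    then show "AE x in M. norm (g x * h x) \<le> B * B"
      using that(3,4) by (auto simp: abs_mult intro!: mult_mono)
  qed measurable
  have rr: "integrable M (\<lambda>x. r x * r x)" by (intro int bound) measurable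
  have r\<sigma>: "integrable M (\<lambda>x. r x * r (\<sigma> e x))" if "e \<in> E" for e
    using that by (intro int bound) measurable
  have \<sigma>\<sigma>: "integrable M (\<lambda>x. r (\<sigma> e x) * r (\<sigma> e x))" if "e \<in> E" for e
    using that by (intro int bound) measurable
  have sq: "(r (\<sigma> e x) - r x)\<^sup>2 = r (\<sigma> e x) * r (\<sigma> e x) + r x * r x - 2 * (r x * r (\<sigma> e x))" for e x
    by (simp add: power2_eq_square algebra_simps)
  have energy_int: "integrable M (\<lambda>x. (r (\<sigma> e x) - r x)\<^sup>2)" if "e \<in> E" for e
    unfolding sq using rr r\<sigma>[OF that] \<sigma>\<sigma>[OF that] by auto
  \<comment> \<open>Invariance under \<sigma> e gives r \<circ> \<sigma> e the same second moment as
    r, so only the cross term depends on e.\<close>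
  have energy: "(\<integral>x. (r (\<sigma> e x) - r x)\<^sup>2 \<partial>M) = 2 * (\<integral>x. r x * r x \<partial>M) - 2 * (\<integral>x. r x * r (\<sigma> e x) \<partial>M)"
    if "e \<in> E" for e
  proof -
    have "(\<integral>x. r (\<sigma> e x) * r (\<sigma> e x) \<partial>M) = (\<integral>x. r x * r x \<partial>distr M M (\<sigma> e))"
      by (rule integral_distr[symmetric, OF \<sigma>(1)[OF that]]) measurable
    then show ?thesis
      unfolding sq using rr r\<sigma>[OF that] \<sigma>\<sigma>[OF that] by (simp add: \<sigma>(2)[OF that])
  qed
  \<comment> \<open>Multiplying harmonicity by r and integrating shows that the cross terms add up
    to card E times the second moment, which cancels the square terms of the energies.\<close>
  have "(\<Sum>e\<in>E. \<integral>x. r x * r (\<sigma> e x) \<partial>M) = (\<integral>x. (\<Sum>e\<in>E. r x * r (\<sigma> e x)) \<partial>M)"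
    using r\<sigma> by (intro Bochner_Integration.integral_sum[symmetric]) auto
  also have "\<dots> = (\<integral>x. real (card E) * (r x * r x) \<partial>M)"
  proof (rule integral_cong_AE)
    show "AE x in M. (\<Sum>e\<in>E. r x * r (\<sigma> e x)) = real (card E) * (r x * r x)"
      using harmonic by eventually_elim (simp add: sum_distrib_left[symmetric] algebra_simps)
  qed measurable
  finally have "(\<Sum>e\<in>E. \<integral>x. (r (\<sigma> e x) - r x)\<^sup>2 \<partial>M) = 0"
    by (simp add: energy sum_subtractf sum_distrib_left[symmetric])
  then have "(\<integral>x. (r (\<sigma> e x) - r x)\<^sup>2 \<partial>M) = 0"
    using E e by (subst (asm) sum_nonneg_eq_0_iff) auto
  then have "AE x in M. (r (\<sigma> e x) - r x)\<^sup>2 = 0"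
    using energy_int[OF e] by (subst (asm) integral_nonneg_eq_0_iff_AE) auto
  then show ?thesis by simp
qed

text \<open>The map T of the overview: the environment viewed from the walk, together with the
  future of the walk.\<close>

definition joint_step :: "'d::finite config \<times> (nat \<Rightarrow> int ^ 'd) \<Rightarrow> 'd config \<times> (nat \<Rightarrow> int ^ 'd)" where
  "joint_step p = (lattice_shift (snd p 1) (fst p), path_step (snd p))"

lemma measurable_joint_step [measurable]:
  "joint_step \<in> (config_space \<Otimes>\<^sub>M path_space) \<rightarrow>\<^sub>M (config_space \<Otimes>\<^sub>M path_space)"
proof -
  have "(\<lambda>p. lattice_shift (snd p 1) (fst p)) \<in> (config_space \<Otimes>\<^sub>M path_space) \<rightarrow>\<^sub>M config_space"
    by (rule measurable_compose_countable[where g = "\<lambda>p. snd p 1"]) measurable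
  then show ?thesis unfolding joint_step_def[abs_def] by measurable
qed

text \<open>Recentring only subtracts a constant from the path, and displacements ignore constants.
  The constant is the position at time k for positive k, but 0 for k = 0, because p need not start
  at the origin.\<close>

lemma joint_step_funpow: "\<exists>c. \<forall>n. snd ((joint_step ^^ k) p) n = snd p (n + k) - c"
proof (induction k)
  case (Suc k)
  then obtain c where c: "\<And>n. snd ((joint_step ^^ k) p) n = snd p (n + k) - c" by blast
  have "snd ((joint_step ^^ Suc k) p) n = snd p (n + Suc k) - snd p (Suc k)" for n
    by (simp add: joint_step_def path_step_def c)
  then show ?case by blast
qed (auto intro: exI[of _ 0])

text \<open>Subtracting the starting point makes the sums along orbits telescope for every p, not
  only for paths from the origin.\<close>

definition displacement :: "'d \<Rightarrow> 'd::finite config \<times> (nat \<Rightarrow> int ^ 'd) \<Rightarrow> real" where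
  "displacement i p = real_of_int (snd p 1 $ i - snd p 0 $ i)"

lemma measurable_displacement [measurable]:
  "displacement i \<in> borel_measurable (config_space \<Otimes>\<^sub>M path_space)"
proof -
  have [measurable]: "(\<lambda>p. real_of_int (snd p n $ i)) \<in> borel_measurable (config_space \<Otimes>\<^sub>M path_space)" for n
    by (rule measurable_compose[where f = "\<lambda>p. snd p n" and N = "count_space UNIV"]) measurable
  show ?thesis unfolding displacement_def[abs_def] of_int_diff by measurable
qed

lemma sum_displacement: "(\<Sum>k<n. displacement i ((joint_step ^^ k) p)) = real_of_int (snd p n $ i - snd p 0 $ i)"
proof -
  have "displacement i ((joint_step ^^ k) p) = real_of_int (snd p (Suc k) $ i) - real_of_int (snd p k $ i)" for k
    using joint_step_funpow[of k p] by (auto simp: displacement_def)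
  then show ?thesis
    using sum_lessThan_telescope[of "\<lambda>k. real_of_int (snd p k $ i)" n] by simp
qed

lemma measurable_quenched_law_subprob [measurable]:
  "quenched_law \<in> config_space \<rightarrow>\<^sub>M subprob_algebra path_space"
  by (rule measurable_prob_algebraD) measurable

text \<open>The Markov property combined with the uniform choice of a direction. The weight W on the
  first step will be 1 for stationarity and harmonicity, and a coordinate of the step for the
  drift.\<close>

lemma nn_integral_joint_step:
  fixes \<omega> :: "'d::finite config" and W :: "int ^ 'd \<Rightarrow> ennreal"
  assumes [measurable]: "h \<in> borel_measurable (config_space \<Otimes>\<^sub>M path_space)"
    and point: "\<And>e. e \<in> directions \<Longrightarrow> has_point e \<omega>"
  shows "(\<integral>\<^sup>+X. W (X 1) * h (joint_step (\<omega>, X)) \<partial>quenched_law \<omega>) =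
    (\<Sum>e\<in>directions. W (int (first_point e \<omega>) *s e) *
       (\<integral>\<^sup>+X. h (first_return e \<omega>, X) \<partial>quenched_law (first_return e \<omega>))) / of_nat (2 * CARD('d))"
proof -
  have [measurable]: "(\<lambda>X. h (\<omega>', X)) \<in> borel_measurable path_space" for \<omega>'
    by measurable
  have "(\<integral>\<^sup>+X. W (X 1) * h (joint_step (\<omega>, X)) \<partial>quenched_law \<omega>) =
     (\<integral>\<^sup>+X. (\<lambda>y X. W y * h (lattice_shift y \<omega>, X)) (X 1) (path_step X) \<partial>quenched_law \<omega>)"
    by (simp add: joint_step_def)
  also have "\<dots> = (\<integral>\<^sup>+y. \<integral>\<^sup>+X. W y * h (lattice_shift y \<omega>, X) \<partial>quenched_law (lattice_shift y \<omega>) \<partial>walk_step \<omega> 0)"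
    by (rule nn_integral_first_step) measurable
  also have "\<dots> = (\<integral>\<^sup>+y. W y * (\<integral>\<^sup>+X. h (lattice_shift y \<omega>, X) \<partial>quenched_law (lattice_shift y \<omega>)) \<partial>walk_step \<omega> 0)"
    by (simp add: nn_integral_cmult)
  also have "\<dots> = (\<Sum>e\<in>directions. W (int (first_point e \<omega>) *s e) *
       (\<integral>\<^sup>+X. h (first_return e \<omega>, X) \<partial>quenched_law (first_return e \<omega>))) / of_nat (2 * CARD('d))"
    unfolding first_return_def by (rule nn_integral_walk_step[OF point])
  finally show ?thesis .
qed

lemma minus_directions: "- e \<in> directions \<longleftrightarrow> e \<in> directions"
proof -
  have "- e \<in> directions" if "e \<in> directions" for e :: "int ^ 'd::finite"
    using that by (auto simp: directions_def)
  from this[of e] this[of "- e"] show ?thesis by auto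
qed

text \<open>Countable quantifiers only, so that the convergence event is measurable.\<close>

lemma tendsto_0_iff_inverse_Suc:
  fixes x :: "nat \<Rightarrow> real"
  shows "x \<longlonglongrightarrow> 0 \<longleftrightarrow> (\<forall>j. \<exists>N. \<forall>n\<ge>N. \<bar>x n\<bar> < inverse (real (Suc j)))"
proof
  assume *: "\<forall>j. \<exists>N. \<forall>n\<ge>N. \<bar>x n\<bar> < inverse (real (Suc j))"
  show "x \<longlonglongrightarrow> 0"
  proof (rule LIMSEQ_I)
    fix r :: real assume "0 < r"
    then obtain j where "inverse (real (Suc j)) < r" using reals_Archimedean by blast
    then show "\<exists>N. \<forall>n\<ge>N. norm (x n - 0) < r" using * by (metis diff_zero less_trans real_norm_def)
  qed
qed (auto simp: LIMSEQ_iff)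

lemma pred_tendsto_0 [measurable]:
  fixes f :: "nat \<Rightarrow> 'a \<Rightarrow> real"
  assumes [measurable]: "\<And>n. f n \<in> borel_measurable M"
  shows "Measurable.pred M (\<lambda>x. (\<lambda>n. f n x) \<longlonglongrightarrow> 0)"
  unfolding tendsto_0_iff_inverse_Suc by measurable

section \<open>The joint law of environment and path, and its invariance under recentring\<close>

context stationary_config
begin

definition joint :: "('d config \<times> (nat \<Rightarrow> int ^ 'd)) measure" where
  "joint = P \<bind> (\<lambda>\<omega>. distr (quenched_law \<omega>) (config_space \<Otimes>\<^sub>M path_space) (Pair \<omega>))"

lemma measurable_joint_kernel [measurable]:
  "(\<lambda>\<omega>. distr (quenched_law \<omega>) (config_space \<Otimes>\<^sub>M path_space) (Pair \<omega>))
     \<in> P \<rightarrow>\<^sub>M subprob_algebra (config_space \<Otimes>\<^sub>M (path_space :: (nat \<Rightarrow> int ^ 'd) measure))"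
  by (rule measurable_distr2[where M = path_space]) measurable

lemma sets_joint [measurable_cong]: "sets joint = sets (config_space \<Otimes>\<^sub>M path_space)"
  unfolding joint_def by (rule sets_bind) auto

lemma space_joint [simp]: "space joint = UNIV"
  using sets_eq_imp_space_eq[OF sets_joint] by (simp add: space_pair_measure)

lemma prob_space_joint: "prob_space joint"
  unfolding joint_def
proof (rule prob_space.prob_space_bind[OF prob_space_P _ measurable_joint_kernel])
  show "AE \<omega> in P. prob_space (distr (quenched_law \<omega>) (config_space \<Otimes>\<^sub>M path_space) (Pair \<omega>))"
    by (intro AE_I2 prob_space.prob_space_distr prob_space_quenched_law) measurable
qed

lemma nn_integral_joint:
  assumes [measurable]: "h \<in> borel_measurable (config_space \<Otimes>\<^sub>M path_space)"
  shows "(\<integral>\<^sup>+p. h p \<partial>joint) = (\<integral>\<^sup>+\<omega>. \<integral>\<^sup>+X. h (\<omega>, X) \<partial>quenched_law \<omega> \<partial>P)"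
  unfolding joint_def
  by (subst nn_integral_bind[OF assms measurable_joint_kernel]) (simp add: nn_integral_distr)

lemma AE_joint:
  assumes "Measurable.pred (config_space \<Otimes>\<^sub>M path_space) R" and "AE p in joint. R p"
  shows "AE \<omega> in P. AE X in quenched_law \<omega>. R (\<omega>, X)"
proof -
  have "AE \<omega> in P. AE p in distr (quenched_law \<omega>) (config_space \<Otimes>\<^sub>M path_space) (Pair \<omega>). R p"
    using assms(2) unfolding joint_def by (subst (asm) AE_bind[OF measurable_joint_kernel assms(1)])
  then show ?thesis
  proof eventually_elim
    case (elim \<omega>)
    show ?case by (rule AE_distrD[OF _ elim]) measurable
  qed
qed

lemma measurable_section [measurable]:
  assumes [measurable]: "h \<in> borel_measurable (config_space \<Otimes>\<^sub>M path_space)"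
  shows "(\<lambda>\<omega>. \<integral>\<^sup>+X. h (\<omega>, X) \<partial>quenched_law \<omega>) \<in> borel_measurable config_space"
  by (rule nn_integral_measurable_subprob_algebra2[where N = path_space]) measurable

text \<open>The environment chain moves by a uniformly chosen first return map. Each of these maps
  preserves \<open>P\<close>, so \<open>P\<close> is stationary for the chain.\<close>

lemma nn_integral_average:
  assumes [measurable]: "g \<in> borel_measurable config_space"
  shows "(\<integral>\<^sup>+\<omega>. (\<Sum>e\<in>directions. g (first_return e \<omega>)) / of_nat (2 * CARD('d)) \<partial>P) = (\<integral>\<^sup>+\<omega>. g \<omega> \<partial>P)"
proof -
  have "(\<integral>\<^sup>+\<omega>. (\<Sum>e\<in>directions. g (first_return e \<omega>)) / of_nat (2 * CARD('d)) \<partial>P) =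
    (\<Sum>e\<in>(directions :: (int ^ 'd) set). \<integral>\<^sup>+\<omega>. g \<omega> \<partial>P) / of_nat (2 * CARD('d))"
    by (simp add: nn_integral_divide nn_integral_sum nn_integral_first_return del: of_nat_mult)
  also have "\<dots> = of_nat (2 * CARD('d)) * (\<integral>\<^sup>+\<omega>. g \<omega> \<partial>P) / of_nat (2 * CARD('d))"
    by (simp only: sum_constant card_directions)
  also have "\<dots> = (\<integral>\<^sup>+\<omega>. g \<omega> \<partial>P)"
    by (simp add: mult.commute[of "of_nat _"] ennreal_mult_divide_eq del: of_nat_mult)
  finally show ?thesis .
qed

text \<open>Conditioning on the first step turns the quenched probability of the section of the
  preimage into the average of the section probabilities of \<open>A\<close> at the first returns;
  stationarity of \<open>P\<close> removes the average.\<close>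

lemma distr_joint_step: "distr joint joint joint_step = joint"
proof (rule measure_eqI)
  fix A assume "A \<in> sets (distr joint joint joint_step)"
  then have [measurable]: "A \<in> sets (config_space \<Otimes>\<^sub>M path_space)" by (simp add: sets_joint)
  have "emeasure (distr joint joint joint_step) A = (\<integral>\<^sup>+p. indicator A p \<partial>distr joint joint joint_step)"
    by (simp add: sets_joint)
  also have "\<dots> = (\<integral>\<^sup>+p. indicator A (joint_step p) \<partial>joint)"
    by (rule nn_integral_distr) measurable
  also have "\<dots> = (\<integral>\<^sup>+\<omega>. \<integral>\<^sup>+X. indicator A (joint_step (\<omega>, X)) \<partial>quenched_law \<omega> \<partial>P)"
    by (rule nn_integral_joint) measurable
  also have "\<dots> = (\<integral>\<^sup>+\<omega>. (\<Sum>e\<in>directions.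
      (\<integral>\<^sup>+X. indicator A (first_return e \<omega>, X) \<partial>quenched_law (first_return e \<omega>))) / of_nat (2 * CARD('d)) \<partial>P)"
  proof (rule nn_integral_cong_AE, use AE_P in eventually_elim)
    case (elim \<omega>)
    then show ?case
      using nn_integral_joint_step[of "indicator A" \<omega> "\<lambda>_. 1"] by simp
  qed
  also have "\<dots> = (\<integral>\<^sup>+\<omega>. \<integral>\<^sup>+X. indicator A (\<omega>, X) \<partial>quenched_law \<omega> \<partial>P)"
    by (rule nn_integral_average) measurable
  also have "\<dots> = (\<integral>\<^sup>+p. indicator A p \<partial>joint)"
    by (rule nn_integral_joint[symmetric]) measurable
  also have "\<dots> = emeasure joint A" by (simp add: sets_joint)
  finally show "emeasure (distr joint joint joint_step) A = emeasure joint A" .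
qed simp

sublocale joint: measure_preserving joint joint_step
proof (intro measure_preserving.intro measure_preserving_axioms.intro)
  show "prob_space joint" by (rule prob_space_joint)
  show "joint_step \<in> joint \<rightarrow>\<^sub>M joint" by measurable
  show "distr joint joint joint_step = joint" by (rule distr_joint_step)
qed

section \<open>Vanishing drift over invariant sets\<close>

definition section_prob :: "('d config \<times> (nat \<Rightarrow> int ^ 'd)) set \<Rightarrow> 'd config \<Rightarrow> ennreal" where
  "section_prob A \<omega> = (\<integral>\<^sup>+X. indicator A (\<omega>, X) \<partial>quenched_law \<omega>)"

lemma measurable_section_prob [measurable]:
  assumes [measurable]: "A \<in> sets (config_space \<Otimes>\<^sub>M path_space)"
  shows "section_prob A \<in> borel_measurable config_space"
  unfolding section_prob_def[abs_def] by measurable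

lemma section_prob_le_1: "section_prob A \<omega> \<le> 1"
proof -
  have "section_prob A \<omega> \<le> (\<integral>\<^sup>+X. 1 \<partial>quenched_law \<omega>)"
    unfolding section_prob_def by (intro nn_integral_mono) (simp add: indicator_def)
  also have "\<dots> = 1"
    using prob_space.emeasure_space_1[OF prob_space_quenched_law, of \<omega>] by simp
  finally show ?thesis .
qed

text \<open>For invariant \<open>A\<close>, conditioning on the first step shows that the section
  probability is harmonic for the environment chain. It lies between 0 and 1 and \<open>P\<close> is
  stationary, so the energy argument applies.\<close>

lemma AE_section_prob_first_return:
  assumes A [measurable]: "A \<in> sets (config_space \<Otimes>\<^sub>M path_space)"
    and inv: "joint_step -` A = A" and e: "e \<in> directions"
  shows "AE \<omega> in P. section_prob A (first_return e \<omega>) = section_prob A \<omega>"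
proof -
  interpret P: prob_space P by (rule prob_space_P)
  let ?r = "\<lambda>\<omega>. enn2real (section_prob A \<omega>)"
  have fin: "section_prob A \<omega> < \<infinity>" for \<omega>
    using section_prob_le_1[of A \<omega>] by (simp add: le_less_trans)
  have eq: "section_prob A \<omega> = ennreal (?r \<omega>)" for \<omega> using fin by simp
  have "AE \<omega> in P. ?r (first_return e \<omega>) = ?r \<omega>"
  proof (rule P.harmonic_imp_invariant[where E = directions and B = 1])
    show "AE \<omega> in P. real (card (directions :: (int ^ 'd) set)) * ?r \<omega> = (\<Sum>e\<in>directions. ?r (first_return e \<omega>))"
      using AE_P
    proof eventually_elim
      case (elim \<omega>)
      have "indicator A (\<omega>, X) = (indicator A (joint_step (\<omega>, X)) :: ennreal)" for X
        using inv by (auto simp: indicator_def)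
      then have "section_prob A \<omega> = (\<integral>\<^sup>+X. 1 * indicator A (joint_step (\<omega>, X)) \<partial>quenched_law \<omega>)"
        by (simp add: section_prob_def)
      also have "\<dots> = (\<Sum>e\<in>directions. section_prob A (first_return e \<omega>)) / of_nat (2 * CARD('d))"
        using elim by (subst nn_integral_joint_step[where W = "\<lambda>_. 1"]) (auto simp: section_prob_def)
      also have "\<dots> = ennreal ((\<Sum>e\<in>directions. ?r (first_return e \<omega>)) / real (2 * CARD('d)))"
        by (subst eq) (simp add: sum_ennreal divide_ennreal sum_nonneg ennreal_of_nat_eq_real_of_nat
            del: of_nat_mult ennreal_enn2real ennreal_enn2real_if)
      finally have "?r \<omega> = (\<Sum>e\<in>directions. ?r (first_return e \<omega>)) / real (2 * CARD('d))"
        by (simp add: sum_nonneg)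
      then show ?case by (simp add: card_directions field_simps)
    qed
    show "\<bar>?r \<omega>\<bar> \<le> 1" for \<omega>
      using section_prob_le_1[of A \<omega>] by (simp add: enn2real_leI)
  qed (use e in \<open>auto simp: finite_directions distr_first_return\<close>)
  then show ?thesis by eventually_elim (subst (1 2) eq, simp only:)
qed

definition weighted_gap :: "('d config \<times> (nat \<Rightarrow> int ^ 'd)) set \<Rightarrow> int ^ 'd \<Rightarrow> ennreal" where
  "weighted_gap A e = (\<integral>\<^sup>+\<omega>. of_nat (first_point e \<omega>) * section_prob A \<omega> \<partial>P)"

lemma weighted_gap_finite: "weighted_gap A e < \<infinity>"
proof -
  have "weighted_gap A e \<le> (\<integral>\<^sup>+\<omega>. of_nat (first_point e \<omega>) * 1 \<partial>P)"
    unfolding weighted_gap_def by (intro nn_integral_mono mult_left_mono section_prob_le_1) simp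
  also have "\<dots> < \<infinity>" using first_point_finite_integral by simp
  finally show ?thesis .
qed

text \<open>Change variables by \<open>first_return e\<close>: it turns the gap along -e into the
  gap along e and leaves the section probability unchanged almost surely.\<close>

lemma weighted_gap_minus:
  assumes [measurable]: "A \<in> sets (config_space \<Otimes>\<^sub>M path_space)"
    and inv: "joint_step -` A = A" and e: "e \<in> directions"
  shows "weighted_gap A (- e) = weighted_gap A e"
proof -
  have "weighted_gap A (- e) = (\<integral>\<^sup>+\<omega>. of_nat (first_point (- e) (first_return e \<omega>)) *
      section_prob A (first_return e \<omega>) \<partial>P)"
    unfolding weighted_gap_def by (rule nn_integral_first_return[symmetric]) measurable
  also have "\<dots> = weighted_gap A e"
    unfolding weighted_gap_def
  proof (rule nn_integral_cong_AE, use AE_P AE_section_prob_first_return[OF assms] in eventually_elim)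
    case (elim \<omega>)
    then show ?case using e by (simp add: first_return_inverse)
  qed
  finally show ?thesis .
qed

text \<open>Invariance of \<open>A\<close> lets its indicator be evaluated after the first step,
  where the Markov property applies. Since \<open>ennreal\<close> truncates at 0, s = 1 and s = -1
  give the positive and negative parts of the displacement.\<close>

lemma nn_integral_displacement:
  assumes A [measurable]: "A \<in> sets (config_space \<Otimes>\<^sub>M path_space)"
    and inv: "joint_step -` A = A"
  shows "(\<integral>\<^sup>+p. ennreal (s * displacement i p) * indicator A p \<partial>joint) =
    (\<Sum>e\<in>directions. ennreal (s * real_of_int (e $ i)) * weighted_gap A e) / of_nat (2 * CARD('d))"
proof -
  have "AE \<omega> in P. \<forall>e\<in>directions. section_prob A (first_return e \<omega>) = section_prob A \<omega>"
    using AE_section_prob_first_return[OF A inv] by (intro AE_finite_allI finite_directions)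
  then have "AE \<omega> in P. (\<integral>\<^sup>+X. ennreal (s * displacement i (\<omega>, X)) * indicator A (\<omega>, X) \<partial>quenched_law \<omega>) =
    (\<Sum>e\<in>directions. ennreal (s * real_of_int (e $ i)) * (of_nat (first_point e \<omega>) * section_prob A \<omega>))
      / of_nat (2 * CARD('d))"
    using AE_P
  proof eventually_elim
    case (elim \<omega>)
    have "(\<integral>\<^sup>+X. ennreal (s * displacement i (\<omega>, X)) * indicator A (\<omega>, X) \<partial>quenched_law \<omega>) =
      (\<integral>\<^sup>+X. ennreal (s * real_of_int (X 1 $ i)) * indicator A (joint_step (\<omega>, X)) \<partial>quenched_law \<omega>)"
    proof (rule nn_integral_cong_AE, use AE_quenched_law_start[of \<omega>] in eventually_elim)
      fix X :: "nat \<Rightarrow> int ^ 'd" assume "X 0 = 0"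
      moreover have "indicator A (\<omega>, X) = (indicator A (joint_step (\<omega>, X)) :: ennreal)"
        using inv by (auto simp: indicator_def)
      ultimately show "ennreal (s * displacement i (\<omega>, X)) * indicator A (\<omega>, X) =
          ennreal (s * real_of_int (X 1 $ i)) * indicator A (joint_step (\<omega>, X))"
        by (simp add: displacement_def)
    qed
    also have "\<dots> = (\<Sum>e\<in>directions. ennreal (s * real_of_int ((int (first_point e \<omega>) *s e) $ i)) *
        section_prob A (first_return e \<omega>)) / of_nat (2 * CARD('d))"
      unfolding section_prob_def
      using elim by (intro nn_integral_joint_step[where W = "\<lambda>y. ennreal (s * real_of_int (y $ i))"]) auto
    also have "(\<Sum>e\<in>directions. ennreal (s * real_of_int ((int (first_point e \<omega>) *s e) $ i)) *
        section_prob A (first_return e \<omega>)) =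
      (\<Sum>e\<in>directions. ennreal (s * real_of_int (e $ i)) * (of_nat (first_point e \<omega>) * section_prob A \<omega>))"
    proof (rule sum.cong[OF refl])
      fix e :: "int ^ 'd" assume e: "e \<in> directions"
      \<comment> \<open>The gap is moved to the front because it is the factor known to be
        nonnegative; the other one may be negative and truncated to 0.\<close>
      have "ennreal (s * real_of_int ((int (first_point e \<omega>) *s e) $ i)) =
          ennreal (real (first_point e \<omega>) * (s * real_of_int (e $ i)))"
        by (simp add: mult.left_commute)
      also have "\<dots> = of_nat (first_point e \<omega>) * ennreal (s * real_of_int (e $ i))"
        by (subst ennreal_mult') (simp_all add: ennreal_of_nat_eq_real_of_nat)
      finally show "ennreal (s * real_of_int ((int (first_point e \<omega>) *s e) $ i)) *
        section_prob A (first_return e \<omega>) =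
        ennreal (s * real_of_int (e $ i)) * (of_nat (first_point e \<omega>) * section_prob A \<omega>)"
        using elim e by (simp add: mult_ac)
    qed
    finally show ?case .
  qed
  then have "(\<integral>\<^sup>+p. ennreal (s * displacement i p) * indicator A p \<partial>joint) =
    (\<integral>\<^sup>+\<omega>. (\<Sum>e\<in>directions. ennreal (s * real_of_int (e $ i)) *
       (of_nat (first_point e \<omega>) * section_prob A \<omega>)) / of_nat (2 * CARD('d)) \<partial>P)"
    by (subst nn_integral_joint) (auto intro!: nn_integral_cong_AE simp del: of_nat_mult)
  also have "\<dots> = (\<Sum>e\<in>directions. ennreal (s * real_of_int (e $ i)) * weighted_gap A e) / of_nat (2 * CARD('d))"
    unfolding weighted_gap_def
    by (simp add: nn_integral_divide nn_integral_sum nn_integral_cmult del: of_nat_mult)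
  finally show ?thesis .
qed

text \<open>Replacing e by -e exchanges the positive and negative parts of the coordinate and
  preserves the weighted gaps.\<close>

lemma nn_integral_displacement_symmetric:
  assumes A: "A \<in> sets (config_space \<Otimes>\<^sub>M path_space)"
    and inv: "joint_step -` A = A"
  shows "(\<integral>\<^sup>+p. ennreal (- displacement i p) * indicator A p \<partial>joint) =
    (\<integral>\<^sup>+p. ennreal (displacement i p) * indicator A p \<partial>joint)"
proof -
  have "(\<Sum>e\<in>directions. ennreal (- 1 * real_of_int (e $ i)) * weighted_gap A e) =
    (\<Sum>e\<in>directions. ennreal (1 * real_of_int (e $ i)) * weighted_gap A e)"
    by (rule sum.reindex_bij_witness[where i = uminus and j = uminus])
       (auto simp: minus_directions weighted_gap_minus[OF A inv])
  then show ?thesis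
    using nn_integral_displacement[OF A inv, of "- 1" i] nn_integral_displacement[OF A inv, of 1 i]
    by simp
qed

text \<open>The whole space is an invariant set, and its weighted gaps are finite by Kac's
  lemma.\<close>

lemma nn_integral_displacement_finite: "(\<integral>\<^sup>+p. ennreal (s * displacement i p) \<partial>joint) < \<infinity>"
proof -
  have "(\<Sum>e\<in>directions. ennreal (s * real_of_int (e $ i)) * weighted_gap UNIV e) < \<infinity>"
    using weighted_gap_finite by (auto simp: ennreal_mult_less_top finite_directions)
  moreover have "(UNIV :: ('d config \<times> (nat \<Rightarrow> int ^ 'd)) set) \<in> sets (config_space \<Otimes>\<^sub>M path_space)"
    using sets.top[of joint] by (simp add: sets_joint)
  ultimately show ?thesis
    using nn_integral_displacement[of UNIV s i]
    by (simp add: ennreal_divide_eq_top_iff less_top[symmetric])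
qed

lemma integrable_displacement: "integrable joint (displacement i)"
proof (rule integrableI_bounded)
  have "(\<integral>\<^sup>+p. ennreal (norm (displacement i p)) \<partial>joint) =
    (\<integral>\<^sup>+p. ennreal (1 * displacement i p) + ennreal (- 1 * displacement i p) \<partial>joint)"
  proof (rule nn_integral_cong)
    fix p :: "'d config \<times> (nat \<Rightarrow> int ^ 'd)"
    show "ennreal (norm (displacement i p)) = ennreal (1 * displacement i p) + ennreal (- 1 * displacement i p)"
      by (cases "0 \<le> displacement i p") (auto simp: ennreal_neg)
  qed
  also have "\<dots> = (\<integral>\<^sup>+p. ennreal (1 * displacement i p) \<partial>joint) + (\<integral>\<^sup>+p. ennreal (- 1 * displacement i p) \<partial>joint)"
    by (rule nn_integral_add) measurable
  also have "\<dots> < \<infinity>"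
    using nn_integral_displacement_finite[of 1 i] nn_integral_displacement_finite[of "- 1" i] by simp
  finally show "(\<integral>\<^sup>+p. ennreal (norm (displacement i p)) \<partial>joint) < \<infinity>" .
qed measurable

text \<open>The positive and negative parts have the same integral, so their difference is
  0.\<close>

lemma integral_displacement_invariant_set:
  assumes A: "A \<in> sets joint" and inv: "joint_step -` A \<inter> space joint = A"
  shows "(\<integral>p. displacement i p * indicator A p \<partial>joint) = 0"
proof -
  have *: "A \<in> sets (config_space \<Otimes>\<^sub>M path_space)" "joint_step -` A = A"
    using assms by (simp_all add: sets_joint)
  have "integrable joint (\<lambda>p. displacement i p * indicator A p)"
    using A by (intro integrable_real_mult_indicator integrable_displacement)
  then have "(\<integral>p. displacement i p * indicator A p \<partial>joint) =
    enn2real (\<integral>\<^sup>+p. ennreal (displacement i p * indicator A p) \<partial>joint) -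
    enn2real (\<integral>\<^sup>+p. ennreal (- (displacement i p * indicator A p)) \<partial>joint)"
    by (rule real_lebesgue_integral_def)
  also have "(\<lambda>p. ennreal (displacement i p * indicator A p)) = (\<lambda>p. ennreal (displacement i p) * indicator A p)"
    by (auto simp: indicator_def)
  also have "(\<lambda>p. ennreal (- (displacement i p * indicator A p))) = (\<lambda>p. ennreal (- displacement i p) * indicator A p)"
    by (auto simp: indicator_def)
  finally show ?thesis by (simp add: nn_integral_displacement_symmetric[OF *])
qed

text \<open>The Birkhoff sums of the displacement telescope to X n - X 0, and X 0 = 0 almost surely;
  the ergodic theorem then passes from the joint law to almost every quenched law.\<close>

lemma AE_quenched_zero_speed:
  "AE \<omega> in P. AE X in quenched_law \<omega>. (\<lambda>n. real_of_int (X n $ i) / real n) \<longlonglongrightarrow> 0"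
proof -
  let ?R = "\<lambda>p. (\<lambda>n. joint.birkhoff_sum (displacement i) n p / real n) \<longlonglongrightarrow> 0"
  have "AE p in joint. ?R p"
    by (intro joint.birkhoff_sum_tendsto_0 integrable_displacement integral_displacement_invariant_set)
  moreover have "Measurable.pred (config_space \<Otimes>\<^sub>M path_space) ?R"
  proof -
    have [measurable]: "joint.birkhoff_sum (displacement i) n \<in> borel_measurable (config_space \<Otimes>\<^sub>M path_space)" for n
      using joint.birkhoff_sum_measurable[of "displacement i" n]
      by (simp add: measurable_cong_sets[OF sets_joint refl])
    show ?thesis by measurable
  qed
  ultimately have "AE \<omega> in P. AE X in quenched_law \<omega>. ?R (\<omega>, X)" by (rule AE_joint[rotated])
  then show ?thesis
  proof eventually_elim
    case (elim \<omega>)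
    then show ?case using AE_quenched_law_start[of \<omega>]
      by eventually_elim (simp add: joint.birkhoff_sum_def sum_displacement)
  qed
qed

end

section \<open>From coordinates to the vector-valued limit under the annealed law\<close>

lemma tendsto_vec_iff:
  fixes f :: "nat \<Rightarrow> 'd::finite \<Rightarrow> real"
  shows "(\<lambda>n. \<chi> i. f n i) \<longlonglongrightarrow> 0 \<longleftrightarrow> (\<forall>i. (\<lambda>n. f n i) \<longlonglongrightarrow> 0)"
proof
  assume *: "(\<lambda>n. \<chi> i. f n i) \<longlonglongrightarrow> 0"
  show "\<forall>i. (\<lambda>n. f n i) \<longlonglongrightarrow> 0"
    using tendsto_vec_nth[OF *] by simp
next
  assume "\<forall>i. (\<lambda>n. f n i) \<longlonglongrightarrow> 0"
  then show "(\<lambda>n. \<chi> i. f n i) \<longlonglongrightarrow> 0"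
    by (intro vec_tendstoI) simp
qed

theorem theorem1p5:
  fixes Q :: "'d::finite config measure"
  assumes "prob_space Q" and "sets Q = sets config_space"
    and stationary: "\<And>i. invariant_measure Q (lattice_shift (axis i 1))"
    and ergodic: "\<And>i. ergodic_measure Q (lattice_shift (axis i 1))"
    and nonempty: "measure Q {\<omega> \<in> space Q. points \<omega> = {}} < 1"
  shows "measure (annealed_law Q)
    {X \<in> space (annealed_law Q).
       (\<lambda>n. (\<chi> i. real_of_int (X n $ i) / real n) :: real ^ 'd) \<longlonglongrightarrow> 0} = 1"
proof -
  interpret stationary_config Q
    using assms by (intro stationary_config.intro stationary_config_axioms.intro)
  have kernel: "quenched_law \<in> conditioned Q \<rightarrow>\<^sub>M subprob_algebra path_space" by measurable
  interpret annealed: prob_space "annealed_law Q"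
    unfolding annealed_law_def
    by (rule prob_space.prob_space_bind[OF prob_space_P _ kernel])
       (simp add: prob_space_quenched_law)
  let ?R = "\<lambda>X. \<forall>i. (\<lambda>n. real_of_int (X n $ i) / real n) \<longlonglongrightarrow> 0"
  have [measurable]: "(\<lambda>X. real_of_int (X n $ i) / real n) \<in> borel_measurable path_space"
    for n and i :: 'd
    by (rule measurable_compose[OF measurable_path]) simp
  have R: "Measurable.pred (path_space :: (nat \<Rightarrow> int ^ 'd) measure) ?R" by measurable
  \<comment> \<open>There are finitely many coordinates, so their exceptional sets can be
    combined.\<close>
  have "AE \<omega> in conditioned Q. AE X in quenched_law \<omega>. ?R X"
    using AE_quenched_zero_speed by (simp add: AE_all_countable)
  then have "AE X in annealed_law Q. ?R X"
    unfolding annealed_law_def by (subst AE_bind[OF kernel R])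
  moreover have "{X \<in> space path_space. ?R X} \<in> sets (path_space :: (nat \<Rightarrow> int ^ 'd) measure)"
    using R by measurable
  then have "{X \<in> space (annealed_law Q). ?R X} \<in> sets (annealed_law Q)"
    using sets_annealed_law[OF assms(2)] sets_eq_imp_space_eq[OF sets_annealed_law[OF assms(2)]]
    by simp
  ultimately have "measure (annealed_law Q) {X \<in> space (annealed_law Q). ?R X} = 1"
    by (subst annealed.prob_Collect_eq_1)
  then show ?thesis by (simp only: tendsto_vec_iff)
qed

end
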